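(* Let $\{(x_k,x_k^* )\}_{k\ge0}$ be generated by the stochastic block Bregman projection (SBBP) method with the decreasing mirror stochastic Polyak stepsize (DecmSPS) $t_k$, under the sampling rule described in the context, where $0<\lambda_k<2$, and suppose the Bregman distance growth condition holds with constant $\gamma>0$. Let $\tilde L=\min\left\{\frac{\mu}{2L_{\max}},\frac{\gamma_b}{\lambda_0}\right\}$. Then the following convergence results hold. (a) In the interpolated case ($\sigma_\tau^2=0$), let $\lambda_k=\frac1c$, $k\in\mathbb{N}$, with $c>\frac12$. This yields a linear convergence rate: $$\mathbb{E}\left[\mathrm{dist}_\psi^{x_k^*}(x_k,\bar X)^2\right]\le\left[1-\frac1c\left(1-\frac1{2c}\right)\gamma\tilde L\right]^k\mathrm{dist}_\psi^{x_0^*}(x_0,\bar X)^2.$$ (b) In the non-interpolated case ($\sigma_\tau^2>0$), let $\lambda_k=\frac{1}{c\sqrt{k+1}}$, $k\in\mathbb{N}$, with $c>0$ (subject to the requirement $0<\lambda_k<2$ above). Then the iterates converge in expectation to the set $\bar X$, with $$\mathbb{E}\left[\mathrm{dist}_\psi^{x_{k+1}^*}(x_{k+1},\bar X)^2\right]\le\left[1-\frac{1}{c\sqrt{k+1}}\left(1-\frac{1}{2c\sqrt{k+1}}\right)\gamma\tilde L\right]\mathbb{E}\left[\mathrm{dist}_\psi^{x_k^*}(x_k,\bar X)^2\right]+\frac{\gamma_b}{\lambda_0}\cdot\frac{\sigma_\tau^2}{c\sqrt{k+1}}.$$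
   Context: Notation: $[m]=\{1,\dots,m\}$; $\mathbb{N}$ includes $0$; $\|\cdot\|$ is the Euclidean norm. Problem data: $\psi:\mathbb{R}^n\to\mathbb{R}$ is $\mu$-strongly convex ($\mu>0$); each $f_i:\mathbb{R}^n\to\mathbb{R}$, $i\in[m]$, is convex and differentiable with $L_i$-Lipschitz gradient, $L_i>0$; $L_{\max}=\max_{i\in[m]}L_i$; $F(x)=\frac1m\sum_{i=1}^mf_i(x)$; $\bar F=\min_{x\in\mathbb{R}^n}F(x)$ and $\bar X=\arg\min_{x\in\mathbb{R}^n}F(x)$ is nonempty. $\psi^*$ is the Fenchel conjugate of $\psi$ (differentiable with $1/\mu$-Lipschitz gradient). For $x^*\in\partial\psi(x)$, $D_\psi^{x^*}(x,y)=\psi(y)-\psi(x)-\langle x^*,y-x\rangle$ and $\mathrm{dist}_\psi^{x^*}(x,\bar X)^2=\inf_{z\in\bar X}D_\psi^{x^*}(x,z)$. Bregman distance growth condition with constant $\gamma>0$: for every $x\in\mathrm{int}\,\mathrm{dom}\,\psi$ ($=\mathbb{R}^n$) and every $x^*\in\partial\psi(x)$, $F(x)-\bar F\ge\gamma\inf_{z\in\bar X}D_\psi^{x^*}(x,z)$. Sampling rule: fix a batch size $\tau\in\{1,\dots,m\}$. At each iteration $k\ge0$ a random subset $J_k\subset[m]$ with $|J_k|=\tau$ is drawn from a distribution with $\mathbf P(i\in J_k)=\tau/m$ for all $i\in[m]$, independently of $J_0,\dots,J_{k-1}$; the weights are $w_{i,k}=w_i=1/\tau$, $i\in J_k$. SBBP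 method: $x_0\in\mathbb{R}^n$, $x_0^*\in\partial\psi(x_0)$ and $$x_{k+1}^*=x_k^*-t_k\sum_{i\in J_k}w_{i,k}\nabla f_i(x_k),\qquad x_{k+1}=\nabla\psi^*(x_{k+1}^* ).$$ DecmSPS: for each $J$ let $l_J^*\in\mathbb{R}$ be any lower bound with $l_J^*\le\inf_{x\in\mathbb{R}^n}\sum_{i\in J}w_if_i(x)$. With a nonincreasing positive sequence $\{\lambda_k\}_{k\ge0}$, $\lambda_{-1}=\lambda_0$ and $t_{-1}=\gamma_b>0$, $$t_k=\lambda_k\min\left\{\mu\cdot\frac{\sum_{i\in J_k}w_{i,k}\left(f_i(x_k)-l_{J_k}^*\right)}{\|\sum_{i\in J_k}w_{i,k}\nabla f_i(x_k)\|^2},\ \frac{t_{k-1}}{\lambda_{k-1}}\right\},\quad k\ge0.$$ Noise constant: fix any $\hat x\in\bar X$ and set $\sigma_\tau^2=\mathbb{E}\left[\sum_{i\in J}w_if_i(\hat x)-l_J^*\right]$, where $J$ has the sampling distribution. *)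

theory Defs
  imports "HOL-Probability.Probability"
begin

definition strongly_convex :: "real \<Rightarrow> ('a::real_inner \<Rightarrow> real) \<Rightarrow> bool" where
  "strongly_convex \<mu> \<psi> \<longleftrightarrow>
     (\<forall>x y. \<forall>s\<in>{0..1}. \<psi> (s *\<^sub>R x + (1 - s) *\<^sub>R y)
        \<le> s * \<psi> x + (1 - s) * \<psi> y - \<mu> / 2 * s * (1 - s) * (norm (x - y))\<^sup>2)"

definition subdifferential :: "('a::real_inner \<Rightarrow> real) \<Rightarrow> 'a \<Rightarrow> 'a set" where
  "subdifferential \<psi> x = {s. \<forall>y. \<psi> y \<ge> \<psi> x + s \<bullet> (y - x)}"

(* Meaningful where f is differentiable; the gradient is then unique. *)
definition grad :: "('a::real_inner \<Rightarrow> real) \<Rightarrow> 'a \<Rightarrow> 'a" where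
  "grad f x = (THE D. GDERIV f x :> D)"

(* Real-valued: for strongly convex finite functions on a Euclidean space the supremum is finite. *)
definition fenchel_conj :: "('a::real_inner \<Rightarrow> real) \<Rightarrow> 'a \<Rightarrow> real" where
  "fenchel_conj \<psi> s = (SUP x. s \<bullet> x - \<psi> x)"

definition bregman_dist :: "('a::real_inner \<Rightarrow> real) \<Rightarrow> 'a \<Rightarrow> 'a \<Rightarrow> 'a \<Rightarrow> real" where
  "bregman_dist \<psi> s x y = \<psi> y - \<psi> x - s \<bullet> (y - x)"

(* This is the squared distance; s is the chosen subgradient at x. *)
definition bregman_dist_set_sq :: "('a::real_inner \<Rightarrow> real) \<Rightarrow> 'a \<Rightarrow> 'a \<Rightarrow> 'a set \<Rightarrow> real" where
  "bregman_dist_set_sq \<psi> s x X = (INF z\<in>X. bregman_dist \<psi> s x z)"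

definition mean_fun :: "nat \<Rightarrow> (nat \<Rightarrow> 'a \<Rightarrow> real) \<Rightarrow> 'a \<Rightarrow> real" where
  "mean_fun m f x = (1 / real m) * (\<Sum>i\<in>{1..m}. f i x)"

definition minimizers :: "('a \<Rightarrow> real) \<Rightarrow> 'a set" where
  "minimizers F = {x. is_arg_min F (\<lambda>_. True) x}"

definition bregman_growth ::
    "('a::real_inner \<Rightarrow> real) \<Rightarrow> ('a \<Rightarrow> real) \<Rightarrow> real \<Rightarrow> bool" where
  "bregman_growth \<psi> F \<gamma> \<longleftrightarrow>
     (\<forall>x. \<forall>s\<in>subdifferential \<psi> x.
        F x - (INF y. F y) \<ge> \<gamma> * bregman_dist_set_sq \<psi> s x (minimizers F))"

definition batches :: "nat \<Rightarrow> nat \<Rightarrow> nat set set" where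
  "batches m \<tau> = {J. J \<subseteq> {1..m} \<and> card J = \<tau>}"

definition batch_fun :: "nat \<Rightarrow> (nat \<Rightarrow> 'a \<Rightarrow> real) \<Rightarrow> nat set \<Rightarrow> 'a \<Rightarrow> real" where
  "batch_fun \<tau> f J x = (\<Sum>i\<in>J. (1 / real \<tau>) * f i x)"

definition batch_grad ::
    "nat \<Rightarrow> (nat \<Rightarrow> 'a::real_inner \<Rightarrow> real) \<Rightarrow> nat set \<Rightarrow> 'a \<Rightarrow> 'a" where
  "batch_grad \<tau> f J x = (\<Sum>i\<in>J. (1 / real \<tau>) *\<^sub>R grad (f i) x)"

definition noise_const ::
    "nat \<Rightarrow> (nat \<Rightarrow> 'a \<Rightarrow> real) \<Rightarrow> nat set pmf \<Rightarrow> (nat set \<Rightarrow> real) \<Rightarrow> 'a \<Rightarrow> real" where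
  "noise_const \<tau> f p l z = measure_pmf.expectation p (\<lambda>J. batch_fun \<tau> f J z - l J)"

(* The next two predicates speak about one realization of the batches J 0, J 1, ... *)
definition sbbp ::
    "('a::real_inner \<Rightarrow> real) \<Rightarrow> nat \<Rightarrow> (nat \<Rightarrow> 'a \<Rightarrow> real) \<Rightarrow> (nat \<Rightarrow> nat set)
      \<Rightarrow> (nat \<Rightarrow> real) \<Rightarrow> (nat \<Rightarrow> 'a) \<Rightarrow> (nat \<Rightarrow> 'a) \<Rightarrow> bool" where
  "sbbp \<psi> \<tau> f J t x xs \<longleftrightarrow>
     (\<forall>k. xs (Suc k) = xs k - t k *\<^sub>R batch_grad \<tau> f (J k) (x k) \<and>
          x (Suc k) = grad (fenchel_conj \<psi>) (xs (Suc k)))"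

(* prev_ratio \<gamma>\<^sub>b lam t k is t (k - 1) / lam (k - 1), with the
   values \<gamma>\<^sub>b and lam 0 at the index -1. *)
fun prev_ratio :: "real \<Rightarrow> (nat \<Rightarrow> real) \<Rightarrow> (nat \<Rightarrow> real) \<Rightarrow> nat \<Rightarrow> real" where
  "prev_ratio \<gamma>\<^sub>b lam t 0 = \<gamma>\<^sub>b / lam 0"
| "prev_ratio \<gamma>\<^sub>b lam t (Suc k) = t k / lam k"

(* If the batch gradient vanishes, the Polyak quotient (including 0/0) counts as infinity, so the
   minimum is the previous ratio; HOL's x / 0 = 0 would instead freeze the method forever. *)
definition decmsps ::
    "real \<Rightarrow> nat \<Rightarrow> (nat \<Rightarrow> 'a::real_inner \<Rightarrow> real) \<Rightarrow> (nat set \<Rightarrow> real) \<Rightarrow> (nat \<Rightarrow> real) \<Rightarrow> real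
      \<Rightarrow> (nat \<Rightarrow> nat set) \<Rightarrow> (nat \<Rightarrow> 'a) \<Rightarrow> (nat \<Rightarrow> real) \<Rightarrow> bool" where
  "decmsps \<mu> \<tau> f l lam \<gamma>\<^sub>b J x t \<longleftrightarrow>
     (\<forall>k. t k = lam k *
        (if batch_grad \<tau> f (J k) (x k) = 0 then prev_ratio \<gamma>\<^sub>b lam t k
         else min (\<mu> * ((batch_fun \<tau> f (J k) (x k) - l (J k)) /
                         (norm (batch_grad \<tau> f (J k) (x k)))\<^sup>2))
                  (prev_ratio \<gamma>\<^sub>b lam t k)))"

end

theory Submission
  imports Defs
begin

text \<open>
  Write \<open>r\<^sub>k = t\<^sub>k / \<lambda>\<^sub>k\<close>. This sequence is nonincreasing, and smoothness bounds the Polyak quotient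
  below by \<open>\<mu> / (2 L\<^sub>m\<^sub>a\<^sub>x)\<close>, so \<open>r\<^sub>k\<close> stays between \<open>Lt\<close> and \<open>\<gamma>\<^sub>b / \<lambda>\<^sub>0\<close>. The mirror descent inequality
  and the Polyak bound \<open>r\<^sub>k \<parallel>g\<parallel>\<^sup>2 \<le> \<mu> (f\<^sub>J(x\<^sub>k) - l\<^sub>J)\<close> give for every minimizer \<open>z\<close>
  \<open>D\<^sub>k\<^sub>+\<^sub>1(z) \<le> D\<^sub>k(z) - \<lambda>\<^sub>k r\<^sub>k (f\<^sub>J(x\<^sub>k) - f\<^sub>J(z)) + \<lambda>\<^sub>k\<^sup>2 r\<^sub>k (f\<^sub>J(x\<^sub>k) - l\<^sub>J) / 2\<close>.
  Bounding \<open>r\<^sub>k\<close> from both sides, averaging over the batch and using the growth condition yields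
  the one-step recursion, hence the linear rate without noise.

  The recursion alone does not imply convergence to 0 in the noisy case, since contraction and
  noise are both of order \<open>\<lambda>\<^sub>k\<close>. There one replaces \<open>r\<^sub>k\<close> by the past value \<open>r\<^sub>k\<^sub>-\<^sub>1\<close>, which is
  independent of the current batch, so that the first-order noise averages out. The error involves
  \<open>r\<^sub>k\<^sub>-\<^sub>1 - r\<^sub>k\<close>, whose expectation tends to 0 by monotonicity, and the weight \<open>1 + r\<^sub>k\<^sub>-\<^sub>1\<close> on the
  distance controls its correlation with the distance.
\<close>

section \<open>Smoothness, strong convexity and Bregman distances\<close>

lemma has_gderiv_grad:
  fixes f :: "'a::euclidean_space \<Rightarrow> real"
  assumes "GDERIV f x :> D"
  shows "grad f x = D"
proof -
  have "E = D" if "GDERIV f x :> E" for E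
  proof -
    have "(\<lambda>h. h \<bullet> E) = (\<lambda>h. h \<bullet> D)"
      using has_derivative_unique assms that unfolding gderiv_def by blast
    then show ?thesis
      by (metis inner_commute inner_eq_zero_iff inner_diff_right right_minus_eq)
  qed
  then show ?thesis
    unfolding grad_def using assms by (rule the_equality[rotated])
qed

text \<open>In Euclidean space a derivative is the inner product with the vector of its values on
  the basis. By uniqueness this vector is what the definite description in \<open>grad\<close>
  picks.\<close>

lemma differentiable_has_gderiv:
  fixes f :: "'a::euclidean_space \<Rightarrow> real"
  assumes "f differentiable (at x)"
  shows "GDERIV f x :> grad f x"
proof -
  obtain f' where f': "(f has_derivative f') (at x)"
    using assms by (auto simp: differentiable_def)
  interpret linear f' using f' by (rule has_derivative_linear)
  have "f' = (\<lambda>h. h \<bullet> (\<Sum>b\<in>Basis. f' b *\<^sub>R b))"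
  proof
    fix h
    have "f' h = f' (\<Sum>b\<in>Basis. (h \<bullet> b) *\<^sub>R b)"
      by (simp add: euclidean_representation)
    also have "\<dots> = h \<bullet> (\<Sum>b\<in>Basis. f' b *\<^sub>R b)"
      by (simp add: sum scale inner_sum_right mult.commute)
    finally show "f' h = h \<bullet> (\<Sum>b\<in>Basis. f' b *\<^sub>R b)" .
  qed
  then have "GDERIV f x :> (\<Sum>b\<in>Basis. f' b *\<^sub>R b)"
    using f' unfolding gderiv_def by simp
  then show ?thesis using has_gderiv_grad by metis
qed

lemma gderiv_along_line:
  assumes "\<And>y. GDERIV f y :> g y"
  shows "((\<lambda>s. f (x + s *\<^sub>R d)) has_real_derivative (d \<bullet> g (x + s *\<^sub>R d))) (at s)"
proof -
  have "((\<lambda>s. x + s *\<^sub>R d) has_derivative (\<lambda>h. h *\<^sub>R d)) (at s)"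
    by (auto intro!: derivative_eq_intros)
  from has_derivative_compose[OF this, of f "\<lambda>h. h \<bullet> g (x + s *\<^sub>R d)"]
  have "((\<lambda>s. f (x + s *\<^sub>R d)) has_derivative (\<lambda>h. (h *\<^sub>R d) \<bullet> g (x + s *\<^sub>R d))) (at s)"
    using assms unfolding gderiv_def by simp
  moreover have "(\<lambda>h. (h *\<^sub>R d) \<bullet> g (x + s *\<^sub>R d)) = (*) (d \<bullet> g (x + s *\<^sub>R d))"
    by (simp add: fun_eq_iff)
  ultimately show ?thesis
    by (simp only: has_field_derivative_def)
qed

text \<open>Along the line through x and y this is the one-dimensional tangent inequality at
  parameter 0.\<close>

lemma convex_on_above_grad:
  fixes f :: "'a::euclidean_space \<Rightarrow> real"
  assumes "convex_on UNIV f" "\<And>y. GDERIV f y :> g y"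
  shows "f y \<ge> f x + g x \<bullet> (y - x)"
proof -
  let ?d = "y - x"
  have "convex_on UNIV (\<lambda>s. f (x + s *\<^sub>R ?d))"
  proof (rule convex_onI)
    fix t a b :: real assume t: "0 < t" "t < 1"
    have "x + ((1 - t) *\<^sub>R a + t *\<^sub>R b) *\<^sub>R ?d = (1 - t) *\<^sub>R (x + a *\<^sub>R ?d) + t *\<^sub>R (x + b *\<^sub>R ?d)"
      by (simp add: algebra_simps)
    then show "f (x + ((1 - t) *\<^sub>R a + t *\<^sub>R b) *\<^sub>R ?d)
      \<le> (1 - t) * f (x + a *\<^sub>R ?d) + t * f (x + b *\<^sub>R ?d)"
      using convex_onD[OF assms(1), of t] t by simp
  qed simp
  moreover have "((\<lambda>s. f (x + s *\<^sub>R ?d)) has_real_derivative ?d \<bullet> g (x + 0 *\<^sub>R ?d)) (at 0)"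
    using gderiv_along_line[OF assms(2)] .
  ultimately have "f (x + 1 *\<^sub>R ?d) - f (x + 0 *\<^sub>R ?d) \<ge> (?d \<bullet> g (x + 0 *\<^sub>R ?d)) * (1 - 0)"
    by (intro convex_on_imp_above_tangent[where A=UNIV and f="\<lambda>s. f (x + s *\<^sub>R ?d)"]) simp_all
  then show ?thesis by (simp add: inner_commute)
qed

text \<open>Once the linear and quadratic terms are subtracted along the segment, the remaining
  function of s has nonpositive derivative on [0,1], because the gradient changes by at most L * s *
  norm (y - x). Comparing its values at 0 and 1 gives the bound.\<close>

lemma lipschitz_grad_descent:
  fixes f :: "'a::euclidean_space \<Rightarrow> real"
  assumes "\<And>y. GDERIV f y :> g y" "L-lipschitz_on UNIV g"
  shows "f y \<le> f x + g x \<bullet> (y - x) + L / 2 * (norm (y - x))\<^sup>2"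
proof -
  let ?d = "y - x"
  let ?h = "\<lambda>s. f (x + s *\<^sub>R ?d) - s * (g x \<bullet> ?d) - L / 2 * s\<^sup>2 * (norm ?d)\<^sup>2"
  have "?h 1 \<le> ?h 0"
  proof (rule DERIV_nonpos_imp_nonincreasing[where f="?h" and a=0 and b=1])
    fix s :: real assume s: "0 \<le> s" "s \<le> 1"
    have "(?h has_real_derivative (?d \<bullet> g (x + s *\<^sub>R ?d)) - g x \<bullet> ?d - L * s * (norm ?d)\<^sup>2) (at s)"
      by (auto intro!: derivative_eq_intros gderiv_along_line[where g=g] assms)
    moreover have "(g (x + s *\<^sub>R ?d) - g x) \<bullet> ?d \<le> L * s * (norm ?d)\<^sup>2"
    proof -
      have "(g (x + s *\<^sub>R ?d) - g x) \<bullet> ?d \<le> norm (g (x + s *\<^sub>R ?d) - g x) * norm ?d"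
        by (rule norm_cauchy_schwarz)
      also have "norm (g (x + s *\<^sub>R ?d) - g x) \<le> L * (s * norm ?d)"
        using lipschitz_onD[OF assms(2), of "x + s *\<^sub>R ?d" x] s by (simp add: dist_norm)
      finally show ?thesis by (simp add: power2_eq_square mult_right_mono algebra_simps)
    qed
    ultimately show "\<exists>D. (?h has_real_derivative D) (at s) \<and> D \<le> 0"
      by (intro exI conjI) (auto simp: inner_diff inner_commute)
  qed simp
  then show ?thesis by simp
qed

text \<open>Compare the subgradient inequality at r y + (1 - r) x with strong convexity there,
  divide by r and let r tend to 0 from the right; the factor 1 - r on the quadratic term then
  becomes 1.\<close>

lemma strongly_convex_subgradient:
  fixes \<psi> :: "'a::euclidean_space \<Rightarrow> real"
  assumes "strongly_convex \<mu> \<psi>" "s \<in> subdifferential \<psi> x"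
  shows "\<psi> y \<ge> \<psi> x + s \<bullet> (y - x) + \<mu> / 2 * (norm (y - x))\<^sup>2"
proof -
  have *: "s \<bullet> (y - x) + \<mu> / 2 * (1 - r) * (norm (y - x))\<^sup>2 \<le> \<psi> y - \<psi> x" if r: "0 < r" "r < 1" for r
  proof -
    have "\<psi> x + s \<bullet> ((r *\<^sub>R y + (1 - r) *\<^sub>R x) - x) \<le> \<psi> (r *\<^sub>R y + (1 - r) *\<^sub>R x)"
      using assms(2) by (simp add: subdifferential_def)
    also have "\<dots> \<le> r * \<psi> y + (1 - r) * \<psi> x - \<mu> / 2 * r * (1 - r) * (norm (y - x))\<^sup>2"
      using assms(1) r unfolding strongly_convex_def by simp
    also have "(r *\<^sub>R y + (1 - r) *\<^sub>R x) - x = r *\<^sub>R (y - x)"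
      by (simp add: algebra_simps)
    finally have "r * (s \<bullet> (y - x) + \<mu> / 2 * (1 - r) * (norm (y - x))\<^sup>2) \<le> r * (\<psi> y - \<psi> x)"
      by (simp add: algebra_simps)
    then show ?thesis using r by simp
  qed
  have "((\<lambda>r. s \<bullet> (y - x) + \<mu> / 2 * (1 - r) * (norm (y - x))\<^sup>2) \<longlongrightarrow>
      s \<bullet> (y - x) + \<mu> / 2 * (1 - 0) * (norm (y - x))\<^sup>2) (at_right 0)"
    by (intro tendsto_intros)
  moreover have "\<forall>\<^sub>F r in at_right 0. s \<bullet> (y - x) + \<mu> / 2 * (1 - r) * (norm (y - x))\<^sup>2 \<le> \<psi> y - \<psi> x"
    unfolding eventually_at_right_field using * by (intro exI[of _ 1]) auto
  ultimately have "s \<bullet> (y - x) + \<mu> / 2 * (1 - 0) * (norm (y - x))\<^sup>2 \<le> \<psi> y - \<psi> x"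
    by (intro tendsto_upperbound) auto
  then show ?thesis by simp
qed

lemma strongly_convex_imp_convex_on:
  assumes "strongly_convex \<mu> \<psi>" "\<mu> \<ge> 0"
  shows "convex_on UNIV \<psi>"
proof (rule convex_onI)
  fix t x y assume t: "0 < (t::real)" "t < 1"
  have "\<psi> (t *\<^sub>R y + (1 - t) *\<^sub>R x)
        \<le> t * \<psi> y + (1 - t) * \<psi> x - \<mu> / 2 * t * (1 - t) * (norm (y - x))\<^sup>2"
    using assms(1) t unfolding strongly_convex_def by simp
  also have "\<dots> \<le> t * \<psi> y + (1 - t) * \<psi> x"
    using t assms(2) by simp
  finally show "\<psi> ((1 - t) *\<^sub>R x + t *\<^sub>R y) \<le> (1 - t) * \<psi> x + t * \<psi> y"
    by (simp add: add.commute)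
qed simp

text \<open>A minimizer of \<open>?h\<close> is the required point, since minimality is the
  subgradient inequality. One exists on a compact ball around x0, and outside the ball quadratic
  growth keeps \<open>?h\<close> at least as large as at x0.\<close>

lemma strongly_convex_conj_attained:
  fixes \<psi> :: "'a::euclidean_space \<Rightarrow> real"
  assumes sc: "strongly_convex \<mu> \<psi>" "\<mu> > 0" and s0: "s0 \<in> subdifferential \<psi> x0"
  obtains x where "s \<in> subdifferential \<psi> x"
proof -
  let ?h = "\<lambda>y. \<psi> y - s \<bullet> y"
  \<comment> \<open>At distance d from x0 the slope difference contributes at most norm (s - s0) *
    d, which is at most \<mu> / 2 * d^2 once d is at least R.\<close>
  define R where "R = 2 / \<mu> * norm (s - s0)"
  have R0: "R \<ge> 0" using sc(2) by (simp add: R_def)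
  have "continuous_on UNIV \<psi>"
    using strongly_convex_imp_convex_on[OF sc(1)] sc(2) by (intro convex_on_continuous) auto
  then have "continuous_on (cball x0 R) ?h"
    by (intro continuous_intros) (auto intro: continuous_on_subset)
  then obtain x where x: "x \<in> cball x0 R" "\<And>y. y \<in> cball x0 R \<Longrightarrow> ?h x \<le> ?h y"
    using continuous_attains_inf[of "cball x0 R" ?h] R0 by auto
  have "?h x \<le> ?h y" for y
  proof (cases "y \<in> cball x0 R")
    case False
    define d where "d = norm (y - x0)"
    have d: "d > R" using False by (simp add: d_def dist_norm norm_minus_commute)
    have "(s - s0) \<bullet> (y - x0) \<le> norm (s - s0) * d"
      unfolding d_def by (rule norm_cauchy_schwarz)
    also have "norm (s - s0) = \<mu> / 2 * R" using sc(2) by (simp add: R_def)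
    also have "\<mu> / 2 * R * d \<le> \<mu> / 2 * d\<^sup>2"
      using d R0 sc(2) by (simp add: power2_eq_square mult_right_mono)
    finally have "(s - s0) \<bullet> (y - x0) \<le> \<mu> / 2 * d\<^sup>2" .
    moreover have "\<psi> y \<ge> \<psi> x0 + s0 \<bullet> (y - x0) + \<mu> / 2 * d\<^sup>2"
      unfolding d_def by (rule strongly_convex_subgradient[OF sc(1) s0])
    ultimately have "?h x0 \<le> ?h y" by (simp add: inner_diff)
    moreover have "?h x \<le> ?h x0" using x(2)[of x0] R0 by simp
    ultimately show ?thesis by linarith
  qed (use x in auto)
  then have "s \<in> subdifferential \<psi> x"
    unfolding subdifferential_def by (auto simp: inner_diff_right algebra_simps)
  then show ?thesis using that by blast
qed

lemma fenchel_conj_subgradient: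
  assumes "s \<in> subdifferential \<psi> x"
  shows "fenchel_conj \<psi> s = s \<bullet> x - \<psi> x"
  unfolding fenchel_conj_def using assms
  by (intro cSup_eq_maximum) (auto simp: subdifferential_def inner_diff_right algebra_simps)

text \<open>Young's inequality with parameter \<mu>, from expanding the square of norm (a - \<mu>
  b).\<close>

lemma square_complete_bound:
  fixes a b :: "'a::real_inner"
  assumes "\<mu> > 0"
  shows "a \<bullet> b \<le> (norm a)\<^sup>2 / (2 * \<mu>) + \<mu> / 2 * (norm b)\<^sup>2"
proof -
  have "0 \<le> (norm (a - \<mu> *\<^sub>R b))\<^sup>2" by simp
  also have "\<dots> = (norm a)\<^sup>2 - 2 * \<mu> * (a \<bullet> b) + \<mu>\<^sup>2 * (norm b)\<^sup>2"
    unfolding power2_norm_eq_inner by (simp add: inner_diff inner_commute algebra_simps power2_eq_square)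
  also have "\<dots> = 2 * \<mu> * ((norm a)\<^sup>2 / (2 * \<mu>) + \<mu> / 2 * (norm b)\<^sup>2 - a \<bullet> b)"
    using assms by (simp add: algebra_simps power2_eq_square)
  finally show ?thesis using assms by (simp add: zero_le_mult_iff)
qed

text \<open>The remainder of the linearization of the conjugate lies between 0 and a multiple of
  norm (s' - s)^2, which gives differentiability and the gradient together. The lower bound is the
  subgradient inequality at the maximizer x' for s'; the upper one is strong convexity at x combined
  with \<open>square_complete_bound\<close>.\<close>

lemma grad_fenchel_conj:
  fixes \<psi> :: "'a::euclidean_space \<Rightarrow> real"
  assumes sc: "strongly_convex \<mu> \<psi>" "\<mu> > 0" and s: "s \<in> subdifferential \<psi> x"
  shows "grad (fenchel_conj \<psi>) s = x"
proof (rule has_gderiv_grad)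
  have bounds: "0 \<le> fenchel_conj \<psi> s' - fenchel_conj \<psi> s - (s' - s) \<bullet> x"
      "fenchel_conj \<psi> s' - fenchel_conj \<psi> s - (s' - s) \<bullet> x \<le> (norm (s' - s))\<^sup>2 / (2 * \<mu>)" for s'
  proof -
    obtain x' where x': "s' \<in> subdifferential \<psi> x'"
      using strongly_convex_conj_attained[OF sc s] .
    note eqs = fenchel_conj_subgradient[OF s] fenchel_conj_subgradient[OF x']
    have "\<psi> x \<ge> \<psi> x' + s' \<bullet> (x - x')" using x' by (simp add: subdifferential_def)
    then show "0 \<le> fenchel_conj \<psi> s' - fenchel_conj \<psi> s - (s' - s) \<bullet> x"
      unfolding eqs by (simp add: inner_diff)
    have "\<psi> x' \<ge> \<psi> x + s \<bullet> (x' - x) + \<mu> / 2 * (norm (x' - x))\<^sup>2"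
      by (rule strongly_convex_subgradient[OF sc(1) s])
    moreover have "(s' - s) \<bullet> (x' - x) \<le> (norm (s' - s))\<^sup>2 / (2 * \<mu>) + \<mu> / 2 * (norm (x' - x))\<^sup>2"
      by (rule square_complete_bound[OF sc(2)])
    ultimately show "fenchel_conj \<psi> s' - fenchel_conj \<psi> s - (s' - s) \<bullet> x \<le> (norm (s' - s))\<^sup>2 / (2 * \<mu>)"
      unfolding eqs by (simp add: inner_diff)
  qed
  have "((\<lambda>s'. (fenchel_conj \<psi> s' - fenchel_conj \<psi> s - (s' - s) \<bullet> x) /\<^sub>R norm (s' - s)) \<longlongrightarrow> 0) (at s)"
  proof (rule tendsto_sandwich)
    show "\<forall>\<^sub>F s' in at s. 0 \<le> (fenchel_conj \<psi> s' - fenchel_conj \<psi> s - (s' - s) \<bullet> x) /\<^sub>R norm (s' - s)"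
      using bounds(1) by (intro always_eventually allI) simp
    show "\<forall>\<^sub>F s' in at s. (fenchel_conj \<psi> s' - fenchel_conj \<psi> s - (s' - s) \<bullet> x) /\<^sub>R norm (s' - s)
        \<le> norm (s' - s) / (2 * \<mu>)"
    proof (intro always_eventually allI)
      fix s'
      have "(fenchel_conj \<psi> s' - fenchel_conj \<psi> s - (s' - s) \<bullet> x) /\<^sub>R norm (s' - s)
          \<le> ((norm (s' - s))\<^sup>2 / (2 * \<mu>)) /\<^sub>R norm (s' - s)"
        by (intro scaleR_left_mono bounds(2)) simp
      then show "(fenchel_conj \<psi> s' - fenchel_conj \<psi> s - (s' - s) \<bullet> x) /\<^sub>R norm (s' - s)
          \<le> norm (s' - s) / (2 * \<mu>)"
        \<comment> \<open>At s' = s both sides are 0, as the inverse of the zero norm is 0.\<close>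
        by (cases "s' = s") (simp_all add: power2_eq_square field_simps)
    qed
    have "((\<lambda>s'. norm (s' - s) / (2 * \<mu>)) \<longlongrightarrow> norm (s - s) / (2 * \<mu>)) (at s)"
      using sc(2) by (intro tendsto_intros) auto
    then show "((\<lambda>s'. norm (s' - s) / (2 * \<mu>)) \<longlongrightarrow> 0) (at s)" by simp
  qed simp
  then show "GDERIV (fenchel_conj \<psi>) s :> x"
    unfolding gderiv_def has_derivative_at_within
    by (simp add: bounded_linear_inner_left)
qed

text \<open>This keeps the dual iterate a subgradient at the primal iterate, the invariant behind
  the later Bregman estimates.\<close>

lemma grad_fenchel_conj_subgradient:
  fixes \<psi> :: "'a::euclidean_space \<Rightarrow> real"
  assumes "strongly_convex \<mu> \<psi>" "\<mu> > 0" "s0 \<in> subdifferential \<psi> x0"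
  shows "s \<in> subdifferential \<psi> (grad (fenchel_conj \<psi>) s)"
proof -
  obtain x where x: "s \<in> subdifferential \<psi> x"
    using strongly_convex_conj_attained[OF assms] .
  with grad_fenchel_conj[OF assms(1,2) x] show ?thesis by simp
qed

section \<open>Bregman distances and the mirror descent step\<close>

lemma bregman_dist_lower:
  fixes \<psi> :: "'a::euclidean_space \<Rightarrow> real"
  assumes "strongly_convex \<mu> \<psi>" "s \<in> subdifferential \<psi> x"
  shows "\<mu> / 2 * (norm (y - x))\<^sup>2 \<le> bregman_dist \<psi> s x y"
  using strongly_convex_subgradient[OF assms, of y] unfolding bregman_dist_def by linarith

lemma bregman_dist_nonneg:
  assumes "s \<in> subdifferential \<psi> x"
  shows "0 \<le> bregman_dist \<psi> s x y"
proof -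
  have "\<psi> y \<ge> \<psi> x + s \<bullet> (y - x)"
    using assms unfolding subdifferential_def by blast
  then show ?thesis unfolding bregman_dist_def by linarith
qed

lemma bregman_dist_set_sq_le:
  assumes "s \<in> subdifferential \<psi> x" "z \<in> X"
  shows "bregman_dist_set_sq \<psi> s x X \<le> bregman_dist \<psi> s x z"
  unfolding bregman_dist_set_sq_def
proof (rule cINF_lower)
  show "bdd_below (bregman_dist \<psi> s x ` X)"
    using bregman_dist_nonneg[OF assms(1)] by (rule bdd_belowI2)
qed (rule assms)

lemma bregman_dist_set_sq_greatest:
  assumes "X \<noteq> {}" "\<And>z. z \<in> X \<Longrightarrow> a \<le> bregman_dist \<psi> s x z"
  shows "a \<le> bregman_dist_set_sq \<psi> s x X"
  unfolding bregman_dist_set_sq_def using assms by (rule cINF_greatest)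

lemma bregman_dist_set_sq_nonneg:
  assumes "X \<noteq> {}" "s \<in> subdifferential \<psi> x"
  shows "0 \<le> bregman_dist_set_sq \<psi> s x X"
  using assms(1) bregman_dist_nonneg[OF assms(2)] by (rule bregman_dist_set_sq_greatest)

text \<open>The two distances differ by - t g . (x - z) + t g . (x - x') - D, where D is the Bregman
  distance from x to x' with subgradient s. Strong convexity makes D large enough to cancel the
  quadratic term that Young's inequality produces from t g . (x - x').\<close>

lemma bregman_dist_mirror_step:
  fixes \<psi> :: "'a::euclidean_space \<Rightarrow> real"
  assumes sc: "strongly_convex \<mu> \<psi>" "\<mu> > 0" and s: "s \<in> subdifferential \<psi> x"
  shows "bregman_dist \<psi> (s - t *\<^sub>R g) x' z
    \<le> bregman_dist \<psi> s x z - t * (g \<bullet> (x - z)) + t\<^sup>2 * (norm g)\<^sup>2 / (2 * \<mu>)"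
proof -
  have "\<psi> x' \<ge> \<psi> x + s \<bullet> (x' - x) + \<mu> / 2 * (norm (x' - x))\<^sup>2"
    by (rule strongly_convex_subgradient[OF sc(1) s])
  moreover have "(t *\<^sub>R g) \<bullet> (x - x') \<le> (norm (t *\<^sub>R g))\<^sup>2 / (2 * \<mu>) + \<mu> / 2 * (norm (x - x'))\<^sup>2"
    by (rule square_complete_bound[OF sc(2)])
  ultimately show ?thesis
    unfolding bregman_dist_def
    by (simp add: inner_diff_left inner_diff_right power_mult_distrib norm_minus_commute[of x x']
        right_diff_distrib left_diff_distrib)
qed

section \<open>Processes driven by independent finite-valued variables\<close>

lemma simple_function_finite_count_space:
  assumes "f \<in> measurable M (count_space N)" "finite N"
  shows "simple_function M f"
  unfolding simple_function_def
proof (intro conjI ballI)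
  have sub: "f ` space M \<subseteq> N"
    using measurable_space[OF assms(1)] by auto
  then show "finite (f ` space M)" using assms(2) finite_subset by blast
  fix y assume "y \<in> f ` space M"
  then show "f -` {y} \<inter> space M \<in> sets M"
    using sub by (intro measurable_sets[OF assms(1)]) auto
qed

text \<open>Displays the state after k steps as a function of the input history alone, so that
  independence of past and present inputs can be applied to it.\<close>

primrec fold_steps :: "(nat \<Rightarrow> 's \<Rightarrow> 'b \<Rightarrow> 's) \<Rightarrow> 's \<Rightarrow> nat \<Rightarrow> (nat \<Rightarrow> 'b) \<Rightarrow> 's" where
  "fold_steps \<Phi> s0 0 h = s0"
| "fold_steps \<Phi> s0 (Suc k) h = \<Phi> k (fold_steps \<Phi> s0 k h) (h k)"

lemma fold_steps_cong:
  "(\<And>i. i < k \<Longrightarrow> h i = h' i) \<Longrightarrow> fold_steps \<Phi> s0 k h = fold_steps \<Phi> s0 k h'"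
  by (induction k) simp_all

text \<open>Inputs from a finite set leave only finitely many states, so the state is a simple
  function for arbitrary transition maps \<Phi>; gradients and conjugates can enter without a
  measurability argument.\<close>

lemma simple_function_fold_steps:
  fixes \<Phi> :: "nat \<Rightarrow> 's \<Rightarrow> 'b \<Rightarrow> 's"
  assumes "finite N" "k \<le> n"
  shows "simple_function (PiM {..<n} (\<lambda>_. count_space N)) (fold_steps \<Phi> s0 k)"
  using assms(2)
proof (induction k)
  case (Suc k)
  have "simple_function (PiM {..<n} (\<lambda>_. count_space N)) (\<lambda>h. h k)"
    using Suc.prems assms(1)
    by (intro simple_function_finite_count_space[where N=N] measurable_component_singleton) auto
  then have "simple_function (PiM {..<n} (\<lambda>_. count_space N)) (\<lambda>h. \<Phi> k (fold_steps \<Phi> s0 k h) (h k))"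
    using Suc by (intro simple_function_compose2[where h="\<Phi> k"]) auto
  then show ?case unfolding fold_steps.simps(2)[symmetric] .
next
  case 0
  have "fold_steps \<Phi> s0 0 = (\<lambda>h :: nat \<Rightarrow> 'b. s0)" for s0 :: 's and \<Phi> by (simp add: fun_eq_iff)
  then show ?case by (simp add: simple_function_const)
qed

context prob_space
begin

lemma expectation_finite_range:
  fixes \<phi> :: "'s \<Rightarrow> real"
  assumes Y: "simple_function M Y" and R: "finite R" "Y ` space M \<subseteq> R"
  shows "expectation (\<lambda>\<omega>. \<phi> (Y \<omega>)) = (\<Sum>y\<in>R. \<phi> y * prob (Y -` {y} \<inter> space M))"
proof -
  have meas: "Y -` {y} \<inter> space M \<in> events" for y
    using measurable_sets[OF measurable_simple_function[OF Y], of "{y}"] by simp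
  have "expectation (\<lambda>\<omega>. \<phi> (Y \<omega>)) =
      expectation (\<lambda>\<omega>. \<Sum>y\<in>R. \<phi> y * indicator (Y -` {y} \<inter> space M) \<omega>)"
  proof (rule Bochner_Integration.integral_cong)
    fix \<omega> assume \<omega>: "\<omega> \<in> space M"
    have "(\<Sum>y\<in>R. \<phi> y * indicator (Y -` {y} \<inter> space M) \<omega>) = (\<Sum>y\<in>R. if y = Y \<omega> then \<phi> y else 0)"
      using \<omega> by (intro sum.cong) auto
    also have "\<dots> = \<phi> (Y \<omega>)"
      using R \<omega> by (subst sum.delta) auto
    finally show "\<phi> (Y \<omega>) = (\<Sum>y\<in>R. \<phi> y * indicator (Y -` {y} \<inter> space M) \<omega>)" ..
  qed simp
  also have "\<dots> = (\<Sum>y\<in>R. expectation (\<lambda>\<omega>. \<phi> y * indicator (Y -` {y} \<inter> space M) \<omega>))"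
    using meas
    by (intro Bochner_Integration.integral_sum integrable_mult_right integrable_real_indicator)
       (auto simp: less_top[symmetric])
  also have "\<dots> = (\<Sum>y\<in>R. \<phi> y * prob (Y -` {y} \<inter> space M))"
    using meas by (intro sum.cong) simp_all
  finally show ?thesis .
qed

lemma integrable_simple_function:
  fixes \<phi> :: "'s \<Rightarrow> real"
  assumes Y: "simple_function M Y"
  shows "integrable M (\<lambda>\<omega>. \<phi> (Y \<omega>))"
proof (rule integrable_const_bound)
  have fin: "finite (Y ` space M)" using Y by (rule simple_functionD)
  show "AE \<omega> in M. norm (\<phi> (Y \<omega>)) \<le> Max ((\<lambda>y. norm (\<phi> y)) ` Y ` space M)"
    using fin by (intro AE_I2 Max_ge) auto
  show "(\<lambda>\<omega>. \<phi> (Y \<omega>)) \<in> borel_measurable M"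
    using borel_measurable_simple_function[OF simple_function_compose1[OF Y, of \<phi>]] by simp
qed

text \<open>This takes the place of conditioning on Y. Both variables have finitely many values, so
  the expectation is a finite sum, and the factorized point probabilities allow the sum over S to be
  carried out first.\<close>

lemma expectation_indep_average:
  fixes g :: "'s \<Rightarrow> 'b \<Rightarrow> real"
  assumes Y: "simple_function M Y" and Z: "Z \<in> measurable M (count_space N)"
    and N: "finite N" "set_pmf p \<subseteq> N"
    and joint: "\<And>y S. S \<in> N \<Longrightarrow>
      prob ((\<lambda>\<omega>. (Y \<omega>, Z \<omega>)) -` {(y, S)} \<inter> space M) = prob (Y -` {y} \<inter> space M) * pmf p S"
  shows "expectation (\<lambda>\<omega>. g (Y \<omega>) (Z \<omega>)) = expectation (\<lambda>\<omega>. measure_pmf.expectation p (g (Y \<omega>)))"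
proof -
  let ?R = "Y ` space M"
  have sZ: "simple_function M Z"
    by (rule simple_function_finite_count_space[OF Z N(1)])
  have fin: "finite ?R" using Y by (rule simple_functionD)
  have sYZ: "simple_function M (\<lambda>\<omega>. (Y \<omega>, Z \<omega>))"
    using Y sZ by (rule simple_function_compose2)
  have range: "(\<lambda>\<omega>. (Y \<omega>, Z \<omega>)) ` space M \<subseteq> ?R \<times> N"
    using measurable_space[OF Z] by auto
  have "expectation (\<lambda>\<omega>. g (Y \<omega>) (Z \<omega>)) =
      (\<Sum>q\<in>?R \<times> N. (case q of (y, S) \<Rightarrow> g y S) * prob ((\<lambda>\<omega>. (Y \<omega>, Z \<omega>)) -` {q} \<inter> space M))"
    using expectation_finite_range[OF sYZ _ range, of "case_prod g"] fin N(1) by simp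
  also have "\<dots> = (\<Sum>q\<in>?R \<times> N. case q of (y, S) \<Rightarrow> g y S * (prob (Y -` {y} \<inter> space M) * pmf p S))"
  proof (rule sum.cong)
    fix q assume "q \<in> ?R \<times> N"
    then obtain y S where q: "q = (y, S)" "S \<in> N" by auto
    show "(case q of (y, S) \<Rightarrow> g y S) * prob ((\<lambda>\<omega>. (Y \<omega>, Z \<omega>)) -` {q} \<inter> space M)
        = (case q of (y, S) \<Rightarrow> g y S * (prob (Y -` {y} \<inter> space M) * pmf p S))"
      using q joint by simp
  qed simp
  also have "\<dots> = (\<Sum>y\<in>?R. (\<Sum>S\<in>N. pmf p S * g y S) * prob (Y -` {y} \<inter> space M))"
    by (simp add: sum.cartesian_product[symmetric] sum_distrib_left sum_distrib_right mult_ac)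
  also have "\<dots> = (\<Sum>y\<in>?R. measure_pmf.expectation p (g y) * prob (Y -` {y} \<inter> space M))"
    using N by (subst integral_measure_pmf[OF N(1)]) auto
  also have "\<dots> = expectation (\<lambda>\<omega>. measure_pmf.expectation p (g (Y \<omega>)))"
    using expectation_finite_range[OF Y fin order_refl, of "\<lambda>y. measure_pmf.expectation p (g y)"] by simp
  finally show ?thesis .
qed

text \<open>\<open>Y k\<close> depends only on the inputs before k, and
  \<open>indep_var_restrict\<close> makes this block independent of \<open>J k\<close>. The events
  are written as preimages of sets in two product spaces to match that form of independence.\<close>

lemma indep_driven_process:
  assumes indep: "indep_vars (\<lambda>_. count_space N) J UNIV" and N: "finite N"
    and Y0: "\<And>\<omega>. \<omega> \<in> space M \<Longrightarrow> Y 0 \<omega> = s0"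
    and YS: "\<And>k \<omega>. \<omega> \<in> space M \<Longrightarrow> Y (Suc k) \<omega> = \<Phi> k (Y k \<omega>) (J k \<omega>)"
  shows "simple_function M (Y k)"
    and "prob ((\<lambda>\<omega>. (Y k \<omega>, J k \<omega>)) -` {(y, S)} \<inter> space M)
      = prob (Y k -` {y} \<inter> space M) * prob (J k -` {S} \<inter> space M)"
proof -
  let ?P = "\<lambda>I. PiM I (\<lambda>_. count_space N)"
  let ?H = "\<lambda>I \<omega>. restrict (\<lambda>i. J i \<omega>) I"
  have J: "random_variable (count_space N) (J i)" for i
    using indep unfolding indep_vars_def by auto
  then have JN: "J i \<omega> \<in> N" if "\<omega> \<in> space M" for i \<omega>
    using measurable_space[OF J that] by simp
  have Y_eq: "Y j \<omega> = fold_steps \<Phi> s0 j (\<lambda>i. J i \<omega>)" if "\<omega> \<in> space M" for j \<omega>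
    using that by (induction j) (simp_all add: Y0 YS)
  have Y_H: "Y k \<omega> = fold_steps \<Phi> s0 k (?H {..<k} \<omega>)" if "\<omega> \<in> space M" for \<omega>
    unfolding Y_eq[OF that] by (rule fold_steps_cong) simp
  have "simple_function M (\<lambda>\<omega>. fold_steps \<Phi> s0 j (\<lambda>i. J i \<omega>))" for j
  proof (induction j)
    case (Suc j)
    from simple_function_compose2[OF Suc simple_function_finite_count_space[OF J N], of "\<Phi> j"]
    show ?case by simp
  qed (simp add: simple_function_const)
  then show "simple_function M (Y k)"
    using simple_function_cong[of M "Y k" "\<lambda>\<omega>. fold_steps \<Phi> s0 k (\<lambda>i. J i \<omega>)"] Y_eq by blast
  define A where "A = fold_steps \<Phi> s0 k -` {y} \<inter> space (?P {..<k})"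
  \<comment> \<open>Intersecting with N keeps the set measurable for every S; for S outside N this
    set and the event that \<open>J k\<close> equals S are both empty.\<close>
  define B where "B = (\<lambda>h. h k) -` ({S} \<inter> N) \<inter> space (?P {k})"
  have A: "A \<in> sets (?P {..<k})"
    unfolding A_def
    by (intro measurable_sets[OF measurable_simple_function[OF simple_function_fold_steps]] N) auto
  have B: "B \<in> sets (?P {k})"
    unfolding B_def by (intro measurable_sets[OF measurable_component_singleton]) auto
  have "indep_var (?P {..<k}) (?H {..<k}) (?P {k}) (?H {k})"
    by (rule indep_var_restrict[OF indep]) auto
  from indep_varD[OF this A B]
  have "prob ((\<lambda>\<omega>. (?H {..<k} \<omega>, ?H {k} \<omega>)) -` (A \<times> B) \<inter> space M)
      = prob (?H {..<k} -` A \<inter> space M) * prob (?H {k} -` B \<inter> space M)" .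
  moreover have "?H {..<k} -` A \<inter> space M = Y k -` {y} \<inter> space M"
    using Y_H JN by (auto simp: A_def space_PiM)
  moreover have "?H {k} -` B \<inter> space M = J k -` {S} \<inter> space M"
    using JN by (auto simp: B_def space_PiM)
  moreover have "(\<lambda>\<omega>. (?H {..<k} \<omega>, ?H {k} \<omega>)) -` (A \<times> B) \<inter> space M
      = (?H {..<k} -` A \<inter> space M) \<inter> (?H {k} -` B \<inter> space M)"
    by auto
  moreover have "(\<lambda>\<omega>. (Y k \<omega>, J k \<omega>)) -` {(y, S)} \<inter> space M
      = (Y k -` {y} \<inter> space M) \<inter> (J k -` {S} \<inter> space M)"
    by auto
  ultimately show "prob ((\<lambda>\<omega>. (Y k \<omega>, J k \<omega>)) -` {(y, S)} \<inter> space M)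
      = prob (Y k -` {y} \<inter> space M) * prob (J k -` {S} \<inter> space M)"
    by simp
qed

end

section \<open>A contraction with vanishing perturbation\<close>

text \<open>Once \<epsilon> stays below \<eta> / 2, an upper bound on b k - \<eta> / 2 shrinks by
  the factor 1 - \<alpha> k <= exp (- \<alpha> k) in each step. Divergence of the sum of \<alpha>
  sends the product of these factors to 0.\<close>

lemma contraction_vanishing_noise_tendsto_0:
  fixes b \<alpha> \<epsilon> :: "nat \<Rightarrow> real"
  assumes rec: "\<forall>\<^sub>F k in sequentially. b (Suc k) \<le> (1 - \<alpha> k) * b k + \<alpha> k * \<epsilon> k"
    and alpha: "\<forall>\<^sub>F k in sequentially. 0 \<le> \<alpha> k \<and> \<alpha> k \<le> 1"
    and diverge: "filterlim (\<lambda>n. \<Sum>k<n. \<alpha> k) at_top sequentially"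
    and eps: "\<epsilon> \<longlonglongrightarrow> 0" and nonneg: "\<And>k. 0 \<le> b k"
  shows "b \<longlonglongrightarrow> 0"
proof (rule LIMSEQ_I)
  fix \<eta> :: real assume \<eta>: "\<eta> > 0"
  have "\<forall>\<^sub>F k in sequentially. \<epsilon> k < \<eta> / 2"
    using eps \<eta> by (intro order_tendstoD) auto
  with rec alpha have "\<forall>\<^sub>F k in sequentially.
      b (Suc k) \<le> (1 - \<alpha> k) * b k + \<alpha> k * \<epsilon> k \<and> 0 \<le> \<alpha> k \<and> \<alpha> k \<le> 1 \<and> \<epsilon> k < \<eta> / 2"
    by eventually_elim auto
  then obtain N where N: "\<And>k. k \<ge> N \<Longrightarrow>
      b (Suc k) \<le> (1 - \<alpha> k) * b k + \<alpha> k * \<epsilon> k \<and> 0 \<le> \<alpha> k \<and> \<alpha> k \<le> 1 \<and> \<epsilon> k < \<eta> / 2"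
    unfolding eventually_sequentially by blast
  define S where "S n = (\<Sum>k<n. \<alpha> k)" for n
  have bound: "b n - \<eta> / 2 \<le> exp (S N - S n) * b N" if "n \<ge> N" for n
    using that
  proof (induction n rule: dec_induct)
    case base
    then show ?case using \<eta> by simp
  next
    case (step n)
    note n = N[OF step(1)]
    have "b (Suc n) - \<eta> / 2 \<le> (1 - \<alpha> n) * b n + \<alpha> n * \<epsilon> n - \<eta> / 2" using n by simp
    also have "\<dots> \<le> (1 - \<alpha> n) * b n + \<alpha> n * (\<eta> / 2) - \<eta> / 2"
      using n by (intro diff_right_mono add_left_mono mult_left_mono) auto
    also have "\<dots> = (1 - \<alpha> n) * (b n - \<eta> / 2)" by (simp add: field_simps)
    also have "\<dots> \<le> (1 - \<alpha> n) * (exp (S N - S n) * b N)"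
      using n step by (intro mult_left_mono) auto
    also have "\<dots> \<le> exp (- \<alpha> n) * (exp (S N - S n) * b N)"
      using exp_ge_add_one_self[of "- \<alpha> n"] nonneg[of N] by (intro mult_right_mono) auto
    also have "\<dots> = exp (S N - S (Suc n)) * b N"
      by (simp add: S_def mult_exp_exp[symmetric] exp_diff exp_add exp_minus field_simps)
    finally show ?case .
  qed
  have "filterlim (\<lambda>n. - S N + S n) at_top sequentially"
    using diverge unfolding S_def by (intro filterlim_tendsto_add_at_top[OF tendsto_const]) auto
  then have "filterlim (\<lambda>n. S N - S n) at_bot sequentially"
    unfolding filterlim_uminus_at_top by (simp add: algebra_simps)
  then have "(\<lambda>n. exp (S N - S n)) \<longlonglongrightarrow> 0"
    by (rule filterlim_compose[OF exp_at_bot])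
  then have "(\<lambda>n. exp (S N - S n) * b N) \<longlonglongrightarrow> 0"
    by (rule tendsto_mult_left_zero)
  then have "\<forall>\<^sub>F n in sequentially. exp (S N - S n) * b N < \<eta> / 2"
    using \<eta> by (intro order_tendstoD) auto
  moreover have "\<forall>\<^sub>F n in sequentially. n \<ge> N" by (rule eventually_ge_at_top)
  ultimately have "\<forall>\<^sub>F n in sequentially. norm (b n - 0) < \<eta>"
  proof eventually_elim
    case (elim n)
    then show ?case using bound[of n] nonneg[of n] by simp
  qed
  then show "\<exists>no. \<forall>n\<ge>no. norm (b n - 0) < \<eta>"
    unfolding eventually_sequentially .
qed

text \<open>Each of the n terms is at least 1 / sqrt n, so the partial sum is at least sqrt
  n.\<close>

lemma sum_inverse_sqrt_at_top:
  "filterlim (\<lambda>n. \<Sum>k<n. 1 / sqrt (real k + 1)) at_top sequentially"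
proof (rule filterlim_at_top_mono)
  show "filterlim (\<lambda>n. sqrt (real n)) at_top sequentially"
    by (rule filterlim_compose[OF sqrt_at_top filterlim_real_sequentially])
  show "\<forall>\<^sub>F n in sequentially. sqrt (real n) \<le> (\<Sum>k<n. 1 / sqrt (real k + 1))"
  proof (intro always_eventually allI)
    fix n
    have "sqrt (real n) = (\<Sum>k<n. 1 / sqrt (real n))"
      by (simp add: real_div_sqrt)
    also have "\<dots> \<le> (\<Sum>k<n. 1 / sqrt (real k + 1))"
      by (intro sum_mono divide_left_mono) auto
    finally show "sqrt (real n) \<le> (\<Sum>k<n. 1 / sqrt (real k + 1))" .
  qed
qed

section \<open>One step of the method\<close>

text \<open>The only randomness here is one batch drawn from p, so a single step can be averaged
  with the current state held fixed.\<close>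

locale sbbp_problem =
  fixes \<psi> :: "'a::euclidean_space \<Rightarrow> real" and f :: "nat \<Rightarrow> 'a \<Rightarrow> real" and L :: "nat \<Rightarrow> real"
    and m \<tau> :: nat and \<mu> \<gamma> :: real and F :: "'a \<Rightarrow> real" and X :: "'a set"
    and p :: "nat set pmf" and l :: "nat set \<Rightarrow> real"
  assumes mu: "\<mu> > 0" and psi: "strongly_convex \<mu> \<psi>"
    and f_conv: "\<And>i. i \<in> {1..m} \<Longrightarrow> convex_on UNIV (f i)"
    and f_diff: "\<And>i y. i \<in> {1..m} \<Longrightarrow> f i differentiable (at y)"
    and f_lip: "\<And>i. i \<in> {1..m} \<Longrightarrow> L i > 0 \<and> (L i)-lipschitz_on UNIV (grad (f i))"
    and F: "F = mean_fun m f" and X: "X = minimizers F" and X_nonempty: "X \<noteq> {}"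
    and gamma: "\<gamma> > 0" and growth: "bregman_growth \<psi> F \<gamma>"
    and tau: "\<tau> \<in> {1..m}" and support: "set_pmf p \<subseteq> batches m \<tau>"
    and marginals: "\<And>i. i \<in> {1..m} \<Longrightarrow> measure_pmf.prob p {S. i \<in> S} = real \<tau> / real m"
    and lower_bound: "\<And>S y. S \<in> batches m \<tau> \<Longrightarrow> l S \<le> batch_fun \<tau> f S y"
begin

section \<open>Batch functions, their mean and the noise constant\<close>

abbreviation "Lmax \<equiv> Max (L ` {1..m})"

lemma Lmax_pos: "Lmax > 0"
proof -
  have "L \<tau> \<le> Lmax" using tau by (intro Max_ge) auto
  then show ?thesis using f_lip[OF tau] by linarith
qed

lemma batchD:
  assumes "S \<in> batches m \<tau>"
  shows "finite S" "card S = \<tau>" "i \<in> S \<Longrightarrow> i \<in> {1..m}"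
  using assms finite_subset[of S "{1..m}"] by (auto simp: batches_def)

lemma finite_batches: "finite (batches m \<tau>)"
  unfolding batches_def by (rule finite_subset[of _ "Pow {1..m}"]) auto

lemma integrable_batch [simp]: "integrable (measure_pmf p) (h :: nat set \<Rightarrow> real)"
  using support finite_batches by (intro integrable_measure_pmf_finite) (rule finite_subset)

lemma expectation_batch_mono:
  assumes "\<And>S. S \<in> set_pmf p \<Longrightarrow> g S \<le> (h S :: real)"
  shows "measure_pmf.expectation p g \<le> measure_pmf.expectation p h"
  using assms by (intro integral_mono_AE) (auto simp: AE_measure_pmf_iff)

lemma batch_above_grad:
  assumes S: "S \<in> batches m \<tau>"
  shows "batch_fun \<tau> f S y \<ge> batch_fun \<tau> f S x + batch_grad \<tau> f S x \<bullet> (y - x)"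
proof -
  have "(\<Sum>i\<in>S. (1 / real \<tau>) * (f i x + grad (f i) x \<bullet> (y - x))) \<le> (\<Sum>i\<in>S. (1 / real \<tau>) * f i y)"
    using batchD[OF S] f_conv f_diff
    by (intro sum_mono mult_left_mono convex_on_above_grad differentiable_has_gderiv) auto
  then show ?thesis
    by (simp add: batch_fun_def batch_grad_def inner_sum_left sum.distrib distrib_left)
qed

lemma batch_descent:
  assumes S: "S \<in> batches m \<tau>"
  shows "batch_fun \<tau> f S y \<le> batch_fun \<tau> f S x + batch_grad \<tau> f S x \<bullet> (y - x) + Lmax / 2 * (norm (y - x))\<^sup>2"
proof -
  have "(\<Sum>i\<in>S. (1 / real \<tau>) * f i y)
      \<le> (\<Sum>i\<in>S. (1 / real \<tau>) * (f i x + grad (f i) x \<bullet> (y - x) + Lmax / 2 * (norm (y - x))\<^sup>2))"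
  proof (intro sum_mono mult_left_mono)
    fix i assume "i \<in> S"
    then have i: "i \<in> {1..m}" using batchD[OF S] by blast
    have "f i y \<le> f i x + grad (f i) x \<bullet> (y - x) + L i / 2 * (norm (y - x))\<^sup>2"
      using f_diff[OF i] f_lip[OF i] by (intro lipschitz_grad_descent differentiable_has_gderiv) auto
    also have "L i / 2 * (norm (y - x))\<^sup>2 \<le> Lmax / 2 * (norm (y - x))\<^sup>2"
      using i by (intro mult_right_mono divide_right_mono Max_ge) auto
    finally show "f i y \<le> f i x + grad (f i) x \<bullet> (y - x) + Lmax / 2 * (norm (y - x))\<^sup>2" by simp
  qed simp
  also have "\<dots> = batch_fun \<tau> f S x + batch_grad \<tau> f S x \<bullet> (y - x)
      + (\<Sum>i\<in>S. (1 / real \<tau>) * (Lmax / 2 * (norm (y - x))\<^sup>2))"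
    by (simp only: batch_fun_def batch_grad_def inner_sum_left sum.distrib distrib_left inner_scaleR_left)
  also have "(\<Sum>i\<in>S. (1 / real \<tau>) * (Lmax / 2 * (norm (y - x))\<^sup>2)) = Lmax / 2 * (norm (y - x))\<^sup>2"
    using batchD[OF S] tau by simp
  finally show ?thesis by (simp add: batch_fun_def)
qed

text \<open>The lower bound \<open>l S\<close> also applies after a gradient step of length 1 /
  Lmax, where the descent inequality estimates the batch function. This keeps the Polyak quotient at
  or above \<mu> / (2 Lmax).\<close>

lemma norm_batch_grad_le:
  assumes S: "S \<in> batches m \<tau>"
  shows "(norm (batch_grad \<tau> f S x))\<^sup>2 \<le> 2 * Lmax * (batch_fun \<tau> f S x - l S)"
proof -
  let ?g = "batch_grad \<tau> f S x"
  have "l S \<le> batch_fun \<tau> f S (x - (1 / Lmax) *\<^sub>R ?g)" by (rule lower_bound[OF S])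
  also have "\<dots> \<le> batch_fun \<tau> f S x - (norm ?g)\<^sup>2 / Lmax + Lmax / 2 * (norm ?g / Lmax)\<^sup>2"
    using batch_descent[OF S, of "x - (1 / Lmax) *\<^sub>R ?g" x] Lmax_pos
    by (simp add: power2_norm_eq_inner[symmetric])
  also have "Lmax / 2 * (norm ?g / Lmax)\<^sup>2 = (norm ?g)\<^sup>2 / Lmax / 2"
    using Lmax_pos by (simp add: power2_eq_square)
  finally have "(norm ?g)\<^sup>2 / Lmax / 2 \<le> batch_fun \<tau> f S x - l S" by simp
  then show ?thesis using Lmax_pos by (simp add: field_simps)
qed

text \<open>With the batch sum written over all indices using membership indicators, the marginals
  \<tau> / m turn the weights 1 / \<tau> into 1 / m.\<close>

lemma expectation_batch_fun:
  "measure_pmf.expectation p (\<lambda>S. batch_fun \<tau> f S z) = F z"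
proof -
  have "measure_pmf.expectation p (\<lambda>S. batch_fun \<tau> f S z)
      = measure_pmf.expectation p (\<lambda>S. \<Sum>i\<in>{1..m}. (1 / real \<tau>) * f i z * indicator {S. i \<in> S} S)"
  proof (intro integral_cong_AE)
    show "AE S in measure_pmf p. batch_fun \<tau> f S z
        = (\<Sum>i\<in>{1..m}. (1 / real \<tau>) * f i z * indicator {S. i \<in> S} S)"
      unfolding AE_measure_pmf_iff
    proof
      fix S assume "S \<in> set_pmf p"
      then have S: "S \<subseteq> {1..m}" using support by (auto simp: batches_def)
      show "batch_fun \<tau> f S z = (\<Sum>i\<in>{1..m}. (1 / real \<tau>) * f i z * indicator {S. i \<in> S} S)"
        unfolding batch_fun_def using S by (intro sum.mono_neutral_cong_left) auto
    qed
  qed simp_all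
  also have "\<dots> = (\<Sum>i\<in>{1..m}. (1 / real \<tau>) * f i z * (real \<tau> / real m))"
    using tau by (subst Bochner_Integration.integral_sum) (auto intro!: sum.cong simp: marginals)
  also have "\<dots> = F z"
    using tau by (simp add: F mean_fun_def sum_distrib_left)
  finally show ?thesis .
qed

lemma expectation_batch_gap:
  "measure_pmf.expectation p (\<lambda>S. batch_fun \<tau> f S z - l S) = F z - measure_pmf.expectation p l"
  by (simp add: expectation_batch_fun)

lemma minimizers_le: "z \<in> X \<Longrightarrow> F z \<le> F y"
  by (auto simp: X minimizers_def is_arg_min_def not_less)

lemma growth_minimizer:
  assumes "z \<in> X" "s \<in> subdifferential \<psi> x"
  shows "\<gamma> * bregman_dist_set_sq \<psi> s x X \<le> F x - F z"
proof -
  have "(INF y. F y) = F z"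
    using minimizers_le[OF assms(1)] by (intro cInf_eq_minimum) auto
  then show ?thesis using growth assms(2) unfolding bregman_growth_def X by force
qed

text \<open>F takes the same value at both minimizers. Hence an estimate that works with its own
  minimizer z still produces the noise constant of the chosen one.\<close>

lemma noise_const_eq:
  assumes "y \<in> X" "z \<in> X"
  shows "noise_const \<tau> f p l y = F z - measure_pmf.expectation p l"
  using minimizers_le[OF assms(1), of z] minimizers_le[OF assms(2), of y]
  unfolding noise_const_def expectation_batch_gap by linarith

lemma noise_const_nonneg: "0 \<le> noise_const \<tau> f p l y"
  unfolding noise_const_def using support lower_bound
  by (intro integral_nonneg_AE) (auto simp: AE_measure_pmf_iff)

section \<open>Stepsize ratios and the state of the method\<close>

definition polyak_ratio :: "real \<Rightarrow> 'a \<Rightarrow> nat set \<Rightarrow> real" where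
  "polyak_ratio r x S = (if batch_grad \<tau> f S x = 0 then r
     else min (\<mu> * ((batch_fun \<tau> f S x - l S) / (norm (batch_grad \<tau> f S x))\<^sup>2)) r)"

lemma polyak_ratio_le: "polyak_ratio r x S \<le> r"
  by (simp add: polyak_ratio_def)

lemma polyak_ratio_ge:
  assumes S: "S \<in> batches m \<tau>" and a: "a \<le> \<mu> / (2 * Lmax)" "a \<le> r"
  shows "a \<le> polyak_ratio r x S"
proof (cases "batch_grad \<tau> f S x = 0")
  case False
  let ?n = "(norm (batch_grad \<tau> f S x))\<^sup>2"
  have n: "?n > 0" using False by simp
  have "1 / (2 * Lmax) \<le> (batch_fun \<tau> f S x - l S) / ?n"
    using norm_batch_grad_le[OF S, of x] n Lmax_pos by (simp add: field_simps)
  then have "\<mu> * (1 / (2 * Lmax)) \<le> \<mu> * ((batch_fun \<tau> f S x - l S) / ?n)"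
    using mu by (intro mult_left_mono) auto
  then show ?thesis using a False by (simp add: polyak_ratio_def)
qed (use a in \<open>simp add: polyak_ratio_def\<close>)

lemma polyak_ratio_norm_grad:
  assumes S: "S \<in> batches m \<tau>"
  shows "polyak_ratio r x S * (norm (batch_grad \<tau> f S x))\<^sup>2 \<le> \<mu> * (batch_fun \<tau> f S x - l S)"
proof (cases "batch_grad \<tau> f S x = 0")
  case False
  let ?n = "(norm (batch_grad \<tau> f S x))\<^sup>2"
  have n: "?n > 0" using False by simp
  have "polyak_ratio r x S * ?n \<le> \<mu> * ((batch_fun \<tau> f S x - l S) / ?n) * ?n"
    using False by (intro mult_right_mono) (auto simp: polyak_ratio_def)
  also have "\<dots> = \<mu> * (batch_fun \<tau> f S x - l S)" using n by simp
  finally show ?thesis .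
qed (use mu lower_bound[OF S] in simp)

text \<open>The third component is the previous quotient of stepsize and relaxation parameter, and
  \<open>polyak_ratio\<close> is its update. Carrying it makes the next state a function of the
  current state and batch, since the stepsize rule refers back to it.\<close>

definition sbbp_step :: "real \<Rightarrow> 'a \<times> 'a \<times> real \<Rightarrow> nat set \<Rightarrow> 'a \<times> 'a \<times> real" where
  "sbbp_step \<eta> = (\<lambda>(x, s, r) S.
     let r' = polyak_ratio r x S; s' = s - (\<eta> * r') *\<^sub>R batch_grad \<tau> f S x
     in (grad (fenchel_conj \<psi>) s', s', r'))"

definition state_dist :: "'a \<times> 'a \<times> real \<Rightarrow> real" where
  "state_dist = (\<lambda>(x, s, r). bregman_dist_set_sq \<psi> s x X)"

definition state_ratio :: "'a \<times> 'a \<times> real \<Rightarrow> real" where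
  "state_ratio = (\<lambda>(x, s, r). r)"

definition valid_state :: "real \<Rightarrow> real \<Rightarrow> 'a \<times> 'a \<times> real \<Rightarrow> bool" where
  "valid_state a R = (\<lambda>(x, s, r). s \<in> subdifferential \<psi> x \<and> a \<le> r \<and> r \<le> R)"

lemma state_dist_nonneg: "valid_state a R st \<Longrightarrow> 0 \<le> state_dist st"
  using bregman_dist_set_sq_nonneg[OF X_nonempty] by (cases st) (auto simp: valid_state_def state_dist_def)

lemma state_ratio_step:
  "state_ratio (sbbp_step \<eta> (x, s, r) S) = polyak_ratio r x S"
  by (simp add: sbbp_step_def state_ratio_def Let_def)

lemma valid_state_step:
  assumes S: "S \<in> batches m \<tau>" and a: "a \<le> \<mu> / (2 * Lmax)" and st: "valid_state a R st"
  shows "valid_state a R (sbbp_step \<eta> st S)"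
proof -
  obtain x s r where [simp]: "st = (x, s, r)" by (cases st)
  have *: "s \<in> subdifferential \<psi> x" "a \<le> r" "r \<le> R" using st by (auto simp: valid_state_def)
  show ?thesis
    using grad_fenchel_conj_subgradient[OF psi mu *(1)] polyak_ratio_ge[OF S a *(2), of x]
      polyak_ratio_le[of r x S] *(3)
    by (simp add: sbbp_step_def valid_state_def Let_def)
qed

text \<open>This is the mirror step inequality with stepsize \<eta> * q. Convexity turns the inner
  product into a difference of batch values, and one of the two factors q in the quadratic term is
  spent on the Polyak bound for q * (norm g)^2.\<close>

lemma state_dist_step:
  assumes S: "S \<in> batches m \<tau>" and z: "z \<in> X" and lam: "\<eta> > 0"
    and a: "0 \<le> a" "a \<le> \<mu> / (2 * Lmax)" and st: "valid_state a R (x, s, r)"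
  shows "state_dist (sbbp_step \<eta> (x, s, r) S) \<le> bregman_dist \<psi> s x z
    - \<eta> * polyak_ratio r x S * (batch_fun \<tau> f S x - batch_fun \<tau> f S z)
    + \<eta>\<^sup>2 * polyak_ratio r x S / 2 * (batch_fun \<tau> f S x - l S)"
proof -
  let ?g = "batch_grad \<tau> f S x" and ?q = "polyak_ratio r x S"
  let ?s' = "s - (\<eta> * ?q) *\<^sub>R ?g"
  let ?x' = "grad (fenchel_conj \<psi>) ?s'"
  have s: "s \<in> subdifferential \<psi> x" and r: "a \<le> r" using st by (auto simp: valid_state_def)
  have q: "0 \<le> ?q" using polyak_ratio_ge[OF S a(2) r, of x] a(1) by linarith
  have "state_dist (sbbp_step \<eta> (x, s, r) S) \<le> bregman_dist \<psi> ?s' ?x' z"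
    using bregman_dist_set_sq_le[OF grad_fenchel_conj_subgradient[OF psi mu s] z]
    by (simp add: sbbp_step_def state_dist_def Let_def)
  also have "\<dots> \<le> bregman_dist \<psi> s x z - \<eta> * ?q * (?g \<bullet> (x - z)) + (\<eta> * ?q)\<^sup>2 * (norm ?g)\<^sup>2 / (2 * \<mu>)"
    by (rule bregman_dist_mirror_step[OF psi mu s])
  also have "\<dots> \<le> bregman_dist \<psi> s x z - \<eta> * ?q * (batch_fun \<tau> f S x - batch_fun \<tau> f S z)
      + \<eta>\<^sup>2 * ?q / 2 * (batch_fun \<tau> f S x - l S)"
  proof (intro add_mono diff_left_mono mult_left_mono)
    show "batch_fun \<tau> f S x - batch_fun \<tau> f S z \<le> ?g \<bullet> (x - z)"
      using batch_above_grad[OF S, of x z] by (simp add: inner_diff)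
    have "(\<eta> * ?q)\<^sup>2 * (norm ?g)\<^sup>2 / (2 * \<mu>) = \<eta>\<^sup>2 * ?q / (2 * \<mu>) * (?q * (norm ?g)\<^sup>2)"
      by (simp add: power2_eq_square)
    also have "\<dots> \<le> \<eta>\<^sup>2 * ?q / (2 * \<mu>) * (\<mu> * (batch_fun \<tau> f S x - l S))"
      using q mu by (intro mult_left_mono polyak_ratio_norm_grad[OF S]) auto
    also have "\<dots> = \<eta>\<^sup>2 * ?q / 2 * (batch_fun \<tau> f S x - l S)"
      using mu by simp
    finally show "(\<eta> * ?q)\<^sup>2 * (norm ?g)\<^sup>2 / (2 * \<mu>) \<le> \<eta>\<^sup>2 * ?q / 2 * (batch_fun \<tau> f S x - l S)" .
  qed (use q lam in simp_all)
  finally show ?thesis .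
qed

text \<open>Averages over batches are first bounded for one fixed minimizer z, and the infimum over
  z is taken only afterwards. This lemma makes that passage; b collects the terms free of z.\<close>

lemma state_dist_greatest:
  assumes "\<And>z. z \<in> X \<Longrightarrow> c \<le> bregman_dist \<psi> s x z + b"
  shows "c \<le> state_dist (x, s, r) + b"
proof -
  have "c - b \<le> bregman_dist_set_sq \<psi> s x X"
    using assms by (intro bregman_dist_set_sq_greatest X_nonempty) (simp add: algebra_simps)
  then show ?thesis by (simp add: state_dist_def)
qed

section \<open>Expected change of the distance in one step\<close>

lemma expected_dist_step:
  assumes lam: "0 < \<eta>" "\<eta> < 2" and a: "0 \<le> a" "a \<le> \<mu> / (2 * Lmax)"
    and st: "valid_state a R st" and y: "y \<in> X"
  shows "measure_pmf.expectation p (\<lambda>S. state_dist (sbbp_step \<eta> st S))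
    \<le> (1 - \<eta> * (1 - \<eta> / 2) * \<gamma> * a) * state_dist st + R * noise_const \<tau> f p l y * \<eta>"
proof -
  obtain x s r where st_eq: "st = (x, s, r)" by (cases st)
  note st = st[unfolded st_eq]
  have s: "s \<in> subdifferential \<psi> x" and r: "a \<le> r" "r \<le> R"
    using st by (auto simp: valid_state_def)
  let ?d = "state_dist (x, s, r)" and ?\<sigma> = "noise_const \<tau> f p l y"
  let ?k = "\<eta> * (1 - \<eta> / 2) * a"
  have k: "?k \<ge> 0" using lam a by simp
  have "measure_pmf.expectation p (\<lambda>S. state_dist (sbbp_step \<eta> (x, s, r) S))
      \<le> ?d + (\<eta> * R * ?\<sigma> - ?k * \<gamma> * ?d)"
  proof (rule state_dist_greatest)
    fix z assume z: "z \<in> X"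
    have \<sigma>: "?\<sigma> = F z - measure_pmf.expectation p l" by (rule noise_const_eq[OF y z])
    have "measure_pmf.expectation p (\<lambda>S. state_dist (sbbp_step \<eta> (x, s, r) S))
        \<le> measure_pmf.expectation p (\<lambda>S. bregman_dist \<psi> s x z
            - ?k * (batch_fun \<tau> f S x - l S) + \<eta> * R * (batch_fun \<tau> f S z - l S))"
    proof (rule expectation_batch_mono)
      fix S assume "S \<in> set_pmf p"
      then have S: "S \<in> batches m \<tau>" using support by blast
      let ?q = "polyak_ratio r x S"
      have q: "a \<le> ?q" "?q \<le> R"
        using polyak_ratio_ge[OF S a(2) r(1)] polyak_ratio_le[of r x S] r(2) by auto
      have "state_dist (sbbp_step \<eta> (x, s, r) S) \<le> bregman_dist \<psi> s x z
          - \<eta> * ?q * (batch_fun \<tau> f S x - batch_fun \<tau> f S z)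
          + \<eta>\<^sup>2 * ?q / 2 * (batch_fun \<tau> f S x - l S)"
        by (rule state_dist_step[OF S z lam(1) a st])
      \<comment> \<open>Both gaps above \<open>l S\<close> are nonnegative, so after this regrouping
        q can be replaced by a in the descent term and by R in the noise term. The first replacement
        uses 1 - \<eta> / 2 >= 0.\<close>
      also have "\<dots> = bregman_dist \<psi> s x z
          - \<eta> * (1 - \<eta> / 2) * ?q * (batch_fun \<tau> f S x - l S) + \<eta> * ?q * (batch_fun \<tau> f S z - l S)"
        by (simp add: algebra_simps power2_eq_square)
      also have "\<dots> \<le> bregman_dist \<psi> s x z - ?k * (batch_fun \<tau> f S x - l S)
          + \<eta> * R * (batch_fun \<tau> f S z - l S)"
        using q lam lower_bound[OF S]
        by (intro add_mono diff_left_mono mult_right_mono mult_left_mono) auto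
      finally show "state_dist (sbbp_step \<eta> (x, s, r) S) \<le> \<dots>" .
    qed
    also have "\<dots> = bregman_dist \<psi> s x z
        - ?k * measure_pmf.expectation p (\<lambda>S. batch_fun \<tau> f S x - l S)
        + \<eta> * R * measure_pmf.expectation p (\<lambda>S. batch_fun \<tau> f S z - l S)"
      by (subst Bochner_Integration.integral_add Bochner_Integration.integral_diff; simp)+
    also have "\<dots> = bregman_dist \<psi> s x z - ?k * (F x - F z + ?\<sigma>) + \<eta> * R * ?\<sigma>"
      unfolding expectation_batch_gap \<sigma> by simp
    also have "\<dots> \<le> bregman_dist \<psi> s x z - ?k * (\<gamma> * ?d) + \<eta> * R * ?\<sigma>"
    proof -
      \<comment> \<open>The noise constant left inside the descent term is nonnegative and only
        helps, so it is dropped.\<close>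
      have "\<gamma> * ?d \<le> F x - F z + ?\<sigma>"
        using growth_minimizer[OF z s] noise_const_nonneg[of y] by (simp add: state_dist_def)
      then have "?k * (\<gamma> * ?d) \<le> ?k * (F x - F z + ?\<sigma>)" using k by (rule mult_left_mono)
      then show ?thesis by simp
    qed
    finally show "measure_pmf.expectation p (\<lambda>S. state_dist (sbbp_step \<eta> (x, s, r) S))
        \<le> bregman_dist \<psi> s x z + (\<eta> * R * ?\<sigma> - ?k * \<gamma> * ?d)" by simp
  qed
  also have "\<dots> = (1 - \<eta> * (1 - \<eta> / 2) * \<gamma> * a) * ?d + R * ?\<sigma> * \<eta>"
    by (simp add: algebra_simps)
  finally show ?thesis unfolding st_eq .
qed

text \<open>The gaps at a minimizer are nonnegative with mean equal to the noise constant, so each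
  is at most that constant divided by the probability of its batch. The bound is uniform over X even
  if X is unbounded.\<close>

lemma batch_gap_minimizers_bounded:
  obtains A where "A \<ge> 0" "\<And>S z. S \<in> set_pmf p \<Longrightarrow> z \<in> X \<Longrightarrow> batch_fun \<tau> f S z - l S \<le> A"
proof -
  obtain y where y: "y \<in> X" using X_nonempty by blast
  let ?\<sigma> = "noise_const \<tau> f p l y"
  have fin: "finite (set_pmf p)" using support finite_batches by (rule finite_subset)
  let ?A = "\<Sum>S\<in>set_pmf p. ?\<sigma> / pmf p S"
  have "batch_fun \<tau> f S z - l S \<le> ?A" if S: "S \<in> set_pmf p" and z: "z \<in> X" for S z
  proof -
    have "pmf p S * (batch_fun \<tau> f S z - l S)
        \<le> (\<Sum>T\<in>set_pmf p. pmf p T * (batch_fun \<tau> f T z - l T))"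
      using fin S support lower_bound by (intro member_le_sum) auto
    also have "\<dots> = measure_pmf.expectation p (\<lambda>T. batch_fun \<tau> f T z - l T)"
      using integral_measure_pmf[OF fin, where M=p and f="\<lambda>T. batch_fun \<tau> f T z - l T"] by simp
    also have "\<dots> = ?\<sigma>"
      unfolding expectation_batch_gap by (rule noise_const_eq[OF y z, symmetric])
    finally have "batch_fun \<tau> f S z - l S \<le> ?\<sigma> / pmf p S"
      using pmf_positive[OF S] by (simp add: pos_le_divide_eq mult.commute)
    also have "\<dots> \<le> ?A"
      using fin S noise_const_nonneg by (intro member_le_sum) auto
    finally show ?thesis .
  qed
  moreover have "?A \<ge> 0" using noise_const_nonneg by (intro sum_nonneg) auto
  ultimately show ?thesis using that by blast
qed

text \<open>The descent inequality started at a minimizer z bounds the gap at x by the gap at z, a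
  gradient term and a quadratic term. \<open>norm_batch_grad_le\<close> bounds the gradient at z by
  the gap at z once more, whence 2 * A; strong convexity turns the quadratic terms into the Bregman
  distance.\<close>

lemma batch_gap_le_state_dist:
  assumes A: "\<And>S z. S \<in> set_pmf p \<Longrightarrow> z \<in> X \<Longrightarrow> batch_fun \<tau> f S z - l S \<le> A"
    and S: "S \<in> set_pmf p" and s: "s \<in> subdifferential \<psi> x"
  shows "batch_fun \<tau> f S x - l S \<le> 2 * A + 2 * Lmax / \<mu> * state_dist (x, s, r)"
proof -
  have Sb: "S \<in> batches m \<tau>" using S support by blast
  have "(batch_fun \<tau> f S x - l S - 2 * A) * \<mu> / (2 * Lmax) \<le> bregman_dist \<psi> s x z" if z: "z \<in> X" for z
  proof -
    let ?g = "batch_grad \<tau> f S z"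
    have "batch_fun \<tau> f S x \<le> batch_fun \<tau> f S z + ?g \<bullet> (x - z) + Lmax / 2 * (norm (x - z))\<^sup>2"
      by (rule batch_descent[OF Sb])
    also have "?g \<bullet> (x - z) \<le> (norm ?g)\<^sup>2 / (2 * Lmax) + Lmax / 2 * (norm (x - z))\<^sup>2"
      by (rule square_complete_bound[OF Lmax_pos])
    also have "(norm ?g)\<^sup>2 / (2 * Lmax) \<le> batch_fun \<tau> f S z - l S"
      using norm_batch_grad_le[OF Sb, of z] Lmax_pos by (simp add: field_simps)
    finally have "batch_fun \<tau> f S x - l S - 2 * A \<le> Lmax * (norm (x - z))\<^sup>2"
      using A[OF S z] by linarith
    then have "(batch_fun \<tau> f S x - l S - 2 * A) * \<mu> / (2 * Lmax)
        \<le> Lmax * (norm (x - z))\<^sup>2 * \<mu> / (2 * Lmax)"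
      using mu Lmax_pos by (intro divide_right_mono mult_right_mono) auto
    also have "\<dots> = \<mu> / 2 * (norm (z - x))\<^sup>2"
      using Lmax_pos by (simp add: norm_minus_commute)
    also have "\<dots> \<le> bregman_dist \<psi> s x z" by (rule bregman_dist_lower[OF psi s])
    finally show ?thesis .
  qed
  then have "(batch_fun \<tau> f S x - l S - 2 * A) * \<mu> / (2 * Lmax) \<le> state_dist (x, s, r) + 0"
    by (intro state_dist_greatest) simp
  then show ?thesis using mu Lmax_pos by (simp add: field_simps)
qed

text \<open>Writing \<open>u = r - r'\<close> for the decrease of the ratio, replacing \<open>r'\<close> by \<open>r\<close> in the descent
  term costs a multiple of \<open>u * state_dist\<close>, which is not small in expectation because \<open>u\<close> and the
  distance are correlated. The weight \<open>1 + r\<close> also loses \<open>u * state_dist\<close> in this step, and for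
  small \<open>\<eta>\<close> this absorbs the cost.\<close>

lemma expected_weighted_dist_step:
  assumes eta: "0 < \<eta>" "\<eta> * (1 + 2 * R) * (2 * Lmax / \<mu>) \<le> 1"
    and a: "0 \<le> a" "a \<le> \<mu> / (2 * Lmax)" and st: "valid_state a R st"
    and A: "A \<ge> 0" "\<And>S z. S \<in> set_pmf p \<Longrightarrow> z \<in> X \<Longrightarrow> batch_fun \<tau> f S z - l S \<le> A"
  shows "measure_pmf.expectation p
      (\<lambda>S. (1 + state_ratio (sbbp_step \<eta> st S)) * state_dist (sbbp_step \<eta> st S))
    \<le> (1 - \<eta> * a * \<gamma>) * ((1 + state_ratio st) * state_dist st)
      + \<eta> * (1 + 2 * R) * (2 * A)
          * measure_pmf.expectation p (\<lambda>S. state_ratio st - state_ratio (sbbp_step \<eta> st S))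
      + \<eta>\<^sup>2 * ((1 + R) * R / 2) * (2 * A + 2 * Lmax / \<mu> * state_dist st)"
proof -
  obtain x s r where st_eq: "st = (x, s, r)" by (cases st)
  note st = st[unfolded st_eq]
  have s: "s \<in> subdifferential \<psi> x" and r: "a \<le> r" "r \<le> R"
    using st by (auto simp: valid_state_def)
  have R: "0 \<le> r" "0 \<le> R" using r a by auto
  define d where "d = state_dist (x, s, r)"
  define B where "B = 2 * Lmax / \<mu>"
  define H where "H = 2 * A + B * d"
  have d: "d \<ge> 0" unfolding d_def by (rule state_dist_nonneg[OF st])
  have B: "B \<ge> 0" using mu Lmax_pos by (simp add: B_def)
  have H: "H \<ge> 0" "A \<le> H" using A(1) B d by (auto simp: H_def)
  let ?E = "measure_pmf.expectation p"
  let ?q = "polyak_ratio r x"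
  \<comment> \<open>\<open>state_dist_greatest\<close> expects the Bregman distance with coefficient
    1, so the weight 1 + r is divided out before the infimum is taken.\<close>
  have divide_weight: "V / (1 + r) \<le> P + (C / (1 + r) - Q)" if "V \<le> (1 + r) * (P - Q) + C" for V P Q C :: real
  proof -
    have "V / (1 + r) \<le> ((1 + r) * (P - Q) + C) / (1 + r)"
      using that R by (intro divide_right_mono) auto
    then show ?thesis using R by (simp add: add_divide_distrib)
  qed
  let ?C = "\<eta> * (1 + 2 * R) * (2 * A) * ?E (\<lambda>S. r - ?q S) + \<eta>\<^sup>2 * ((1 + R) * R / 2) * H"
  have "?E (\<lambda>S. (1 + ?q S) * state_dist (sbbp_step \<eta> (x, s, r) S)) / (1 + r)
      \<le> d + (?C / (1 + r) - \<eta> * a * \<gamma> * d)"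
    unfolding d_def
  proof (rule state_dist_greatest)
    fix z assume z: "z \<in> X"
    let ?D = "bregman_dist \<psi> s x z"
    have dD: "d \<le> ?D" using bregman_dist_set_sq_le[OF s z] by (simp add: d_def state_dist_def)
    have "?E (\<lambda>S. (1 + ?q S) * state_dist (sbbp_step \<eta> (x, s, r) S))
      \<le> ?E (\<lambda>S. (1 + r) * (?D - \<eta> * r * (batch_fun \<tau> f S x - batch_fun \<tau> f S z))
            + \<eta> * (1 + 2 * R) * (2 * A) * (r - ?q S) + \<eta>\<^sup>2 * ((1 + R) * R / 2) * H)"
    proof (rule expectation_batch_mono)
      fix S assume Sp: "S \<in> set_pmf p"
      then have S: "S \<in> batches m \<tau>" using support by blast
      define q where "q = ?q S"
      define G where "G = batch_fun \<tau> f S x - batch_fun \<tau> f S z"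
      define u where "u = r - q"
      have q: "a \<le> q" "q \<le> r"
        using polyak_ratio_ge[OF S a(2) r(1)] polyak_ratio_le[of r x S] by (auto simp: q_def)
      have u: "u \<ge> 0" and q0: "q \<ge> 0" using q a by (auto simp: u_def)
      have gap: "batch_fun \<tau> f S x - l S \<le> H"
        using batch_gap_le_state_dist[OF A(2) Sp s, of r] by (simp add: H_def B_def d_def)
      have G: "G \<le> H" "- H \<le> G"
        using gap H lower_bound[OF S, of z] lower_bound[OF S, of x] A(2)[OF Sp z] by (auto simp: G_def)
      have "state_dist (sbbp_step \<eta> (x, s, r) S)
          \<le> ?D - \<eta> * q * G + \<eta>\<^sup>2 * q / 2 * (batch_fun \<tau> f S x - l S)"
        unfolding q_def G_def by (rule state_dist_step[OF S z eta(1) a st])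
      also have "\<dots> \<le> ?D - \<eta> * q * G + \<eta>\<^sup>2 * R / 2 * H"
        using gap q r R lower_bound[OF S, of x]
        by (intro add_left_mono mult_mono divide_right_mono mult_left_mono) auto
      finally have "(1 + q) * state_dist (sbbp_step \<eta> (x, s, r) S)
          \<le> (1 + q) * (?D - \<eta> * q * G + \<eta>\<^sup>2 * R / 2 * H)"
        using q0 by (intro mult_left_mono) auto
      \<comment> \<open>Substituting q = r - u: the falling weight yields - u * \<open>?D\<close>,
        and passing from (1 + q) * q to (1 + r) * r costs \<eta> * u * (1 + r + q) * G.\<close>
      also have "\<dots> = (1 + r) * (?D - \<eta> * r * G) - u * ?D
          + \<eta> * u * (r * G + (1 + q) * G) + (1 + q) * (\<eta>\<^sup>2 * R / 2 * H)"
        by (simp add: u_def algebra_simps)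
      also have "\<dots> \<le> (1 + r) * (?D - \<eta> * r * G) - u * d
          + \<eta> * u * ((1 + 2 * R) * H) + (1 + R) * (\<eta>\<^sup>2 * R / 2 * H)"
      proof (intro add_mono diff_left_mono mult_left_mono mult_right_mono)
        have "r * G + (1 + q) * G = (1 + r + q) * G" by (simp add: algebra_simps)
        also have "\<dots> \<le> (1 + r + q) * H" using G q0 R by (intro mult_left_mono) auto
        also have "\<dots> \<le> (1 + 2 * R) * H" using H q r by (intro mult_right_mono) auto
        finally show "r * G + (1 + q) * G \<le> (1 + 2 * R) * H" .
      qed (use u dD eta H R q r in auto)
      \<comment> \<open>Splitting H = 2 * A + B * d isolates u * d with coefficient \<eta> * (1 + 2
        * R) * B - 1, which is nonpositive by the smallness assumption on \<eta>.\<close>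
      also have "\<dots> = (1 + r) * (?D - \<eta> * r * G) + \<eta> * (1 + 2 * R) * (2 * A) * u
          + \<eta>\<^sup>2 * ((1 + R) * R / 2) * H + u * d * (\<eta> * (1 + 2 * R) * B - 1)"
        by (simp add: H_def algebra_simps)
      also have "\<dots> \<le> (1 + r) * (?D - \<eta> * r * G) + \<eta> * (1 + 2 * R) * (2 * A) * u
          + \<eta>\<^sup>2 * ((1 + R) * R / 2) * H"
        using u d eta(2) mult_nonneg_nonpos[of "u * d" "\<eta> * (1 + 2 * R) * B - 1"] by (simp add: B_def)
      finally show "(1 + ?q S) * state_dist (sbbp_step \<eta> (x, s, r) S)
          \<le> (1 + r) * (?D - \<eta> * r * (batch_fun \<tau> f S x - batch_fun \<tau> f S z))
            + \<eta> * (1 + 2 * R) * (2 * A) * (r - ?q S) + \<eta>\<^sup>2 * ((1 + R) * R / 2) * H"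
        by (simp add: q_def G_def u_def)
    qed
    \<comment> \<open>Since r is fixed while S varies, the first-order term averages exactly to r *
      (F x - F z).\<close>
    also have "\<dots> = (1 + r) * (?D - \<eta> * r * ?E (\<lambda>S. batch_fun \<tau> f S x - batch_fun \<tau> f S z)) + ?C"
      by (subst Bochner_Integration.integral_add Bochner_Integration.integral_diff
            integral_mult_right_zero; simp)+
    also have "?E (\<lambda>S. batch_fun \<tau> f S x - batch_fun \<tau> f S z) = F x - F z"
      by (simp add: expectation_batch_fun)
    also have "(1 + r) * (?D - \<eta> * r * (F x - F z)) + ?C \<le> (1 + r) * (?D - \<eta> * a * \<gamma> * d) + ?C"
    proof -
      have "\<gamma> * d \<le> F x - F z"
        using growth_minimizer[OF z s] by (simp add: d_def state_dist_def)
      then have "a * (\<gamma> * d) \<le> r * (F x - F z)"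
        using r a gamma d by (intro mult_mono) auto
      then have "\<eta> * (a * (\<gamma> * d)) \<le> \<eta> * (r * (F x - F z))"
        using eta(1) by (intro mult_left_mono) auto
      then show ?thesis
        using R by (intro add_right_mono mult_left_mono diff_left_mono) (auto simp: mult.assoc)
    qed
    finally have "?E (\<lambda>S. (1 + ?q S) * state_dist (sbbp_step \<eta> (x, s, r) S))
        \<le> (1 + r) * (?D - \<eta> * a * \<gamma> * d) + ?C" .
    then show "?E (\<lambda>S. (1 + ?q S) * state_dist (sbbp_step \<eta> (x, s, r) S)) / (1 + r)
        \<le> ?D + (?C / (1 + r) - \<eta> * a * \<gamma> * state_dist (x, s, r))"
      unfolding d_def by (rule divide_weight)
  qed
  then have "?E (\<lambda>S. (1 + ?q S) * state_dist (sbbp_step \<eta> (x, s, r) S))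
      \<le> (1 + r) * (d + (?C / (1 + r) - \<eta> * a * \<gamma> * d))"
    using R by (simp add: pos_divide_le_eq mult.commute)
  also have "\<dots> = (1 - \<eta> * a * \<gamma>) * ((1 + r) * d) + ?C"
  proof -
    have "(1 + r) * (d + (e - Q * d)) = (1 - Q) * ((1 + r) * d) + (1 + r) * e" for e Q
      by (simp add: algebra_simps)
    then show ?thesis using R by simp
  qed
  finally show ?thesis
    unfolding st_eq state_ratio_step d_def[symmetric]
    by (simp add: H_def B_def state_ratio_def)
qed

end

section \<open>The stochastic process\<close>

locale sbbp_process = sbbp_problem \<psi> f L m \<tau> \<mu> \<gamma> F X p l + prob_space M
  for \<psi> :: "'a::euclidean_space \<Rightarrow> real" and f :: "nat \<Rightarrow> 'a \<Rightarrow> real" and L :: "nat \<Rightarrow> real"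
    and m \<tau> :: nat and \<mu> \<gamma> :: real and F :: "'a \<Rightarrow> real" and X :: "'a set"
    and p :: "nat set pmf" and l :: "nat set \<Rightarrow> real" and M :: "'w measure" +
  fixes J :: "nat \<Rightarrow> 'w \<Rightarrow> nat set" and lam :: "nat \<Rightarrow> real" and \<gamma>\<^sub>b :: real
    and t :: "nat \<Rightarrow> 'w \<Rightarrow> real" and x xs :: "nat \<Rightarrow> 'w \<Rightarrow> 'a" and x0 xs0 :: 'a
  assumes J_indep: "indep_vars (\<lambda>_. count_space (batches m \<tau>)) J UNIV"
    and J_distr: "\<And>k. distr M (count_space UNIV) (J k) = measure_pmf p"
    and lam: "\<And>k. 0 < lam k" "\<And>k. lam k < 2" and gamma_b: "\<gamma>\<^sub>b > 0"
    and initial: "xs0 \<in> subdifferential \<psi> x0"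
      "\<And>\<omega>. \<omega> \<in> space M \<Longrightarrow> x 0 \<omega> = x0 \<and> xs 0 \<omega> = xs0"
    and iterates: "\<And>\<omega>. \<omega> \<in> space M \<Longrightarrow>
      sbbp \<psi> \<tau> f (\<lambda>k. J k \<omega>) (\<lambda>k. t k \<omega>) (\<lambda>k. x k \<omega>) (\<lambda>k. xs k \<omega>)"
    and stepsizes: "\<And>\<omega>. \<omega> \<in> space M \<Longrightarrow>
      decmsps \<mu> \<tau> f l lam \<gamma>\<^sub>b (\<lambda>k. J k \<omega>) (\<lambda>k. x k \<omega>) (\<lambda>k. t k \<omega>)"
begin

abbreviation "R \<equiv> \<gamma>\<^sub>b / lam 0"

abbreviation "Lt \<equiv> min (\<mu> / (2 * Lmax)) R"

text \<open>Iterate k is paired with the ratio from step k - 1, because that is the one step k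
  consults.\<close>

definition state :: "nat \<Rightarrow> 'w \<Rightarrow> 'a \<times> 'a \<times> real" where
  "state k \<omega> = (x k \<omega>, xs k \<omega>, prev_ratio \<gamma>\<^sub>b lam (\<lambda>k. t k \<omega>) k)"

definition mean_dist :: "nat \<Rightarrow> real" where
  "mean_dist k = expectation (\<lambda>\<omega>. state_dist (state k \<omega>))"

lemma mean_dist_eq: "mean_dist k = expectation (\<lambda>\<omega>. bregman_dist_set_sq \<psi> (xs k \<omega>) (x k \<omega>) X)"
  by (simp add: mean_dist_def state_def state_dist_def)

lemma R_pos: "R > 0"
  using gamma_b lam(1)[of 0] by simp

lemma Lt_pos: "Lt > 0"
  using R_pos mu Lmax_pos by simp

lemma state_0: "\<omega> \<in> space M \<Longrightarrow> state 0 \<omega> = (x0, xs0, R)"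
  using initial(2) by (simp add: state_def)

lemma state_Suc:
  assumes "\<omega> \<in> space M"
  shows "state (Suc k) \<omega> = sbbp_step (lam k) (state k \<omega>) (J k \<omega>)"
proof -
  define q where "q = polyak_ratio (prev_ratio \<gamma>\<^sub>b lam (\<lambda>k. t k \<omega>) k) (x k \<omega>) (J k \<omega>)"
  have t: "t k \<omega> = lam k * q"
    using stepsizes[OF assms] unfolding decmsps_def polyak_ratio_def q_def by blast
  then have "t k \<omega> / lam k = q" using lam(1)[of k] by simp
  moreover have "xs (Suc k) \<omega> = xs k \<omega> - (lam k * q) *\<^sub>R batch_grad \<tau> f (J k \<omega>) (x k \<omega>)"
      "x (Suc k) \<omega> = grad (fenchel_conj \<psi>) (xs (Suc k) \<omega>)"
    using iterates[OF assms] t unfolding sbbp_def by auto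
  ultimately show ?thesis
    by (simp add: state_def sbbp_step_def Let_def q_def)
qed

lemma J_measurable: "J k \<in> measurable M (count_space (batches m \<tau>))"
  using J_indep unfolding indep_vars_def by auto

lemma J_batches: "\<omega> \<in> space M \<Longrightarrow> J k \<omega> \<in> batches m \<tau>"
  using measurable_space[OF J_measurable] by simp

lemma prob_J: "prob (J k -` {S} \<inter> space M) = pmf p S"
proof -
  have "J k \<in> measurable M (count_space UNIV)"
    by (rule measurable_simple_function)
       (rule simple_function_finite_count_space[OF J_measurable finite_batches])
  then have "measure (distr M (count_space UNIV) (J k)) {S} = prob (J k -` {S} \<inter> space M)"
    by (rule measure_distr) simp
  then show ?thesis by (simp add: J_distr pmf.rep_eq)
qed

lemma simple_function_state: "simple_function M (state k)"
  using indep_driven_process(1)[where Y=state and \<Phi>="\<lambda>k. sbbp_step (lam k)",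
    OF J_indep finite_batches state_0 state_Suc] .

lemma integrable_state [simp]: "integrable M (\<lambda>\<omega>. h (state k \<omega>) :: real)"
  by (rule integrable_simple_function[OF simple_function_state])

text \<open>The batch can be averaged with the state held fixed because \<open>J k\<close> is
  independent of \<open>state k\<close>. Letting g see both states covers the decrease of the ratio
  as well as functions of the new state alone.\<close>

lemma expectation_state_Suc:
  fixes g :: "'a \<times> 'a \<times> real \<Rightarrow> 'a \<times> 'a \<times> real \<Rightarrow> real"
  shows "expectation (\<lambda>\<omega>. g (state k \<omega>) (state (Suc k) \<omega>))
    = expectation (\<lambda>\<omega>. measure_pmf.expectation p (\<lambda>S. g (state k \<omega>) (sbbp_step (lam k) (state k \<omega>) S)))"
proof -
  have "expectation (\<lambda>\<omega>. g (state k \<omega>) (state (Suc k) \<omega>))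
      = expectation (\<lambda>\<omega>. g (state k \<omega>) (sbbp_step (lam k) (state k \<omega>) (J k \<omega>)))"
    by (rule Bochner_Integration.integral_cong) (simp_all add: state_Suc)
  also have "\<dots> = expectation (\<lambda>\<omega>. measure_pmf.expectation p
      (\<lambda>S. g (state k \<omega>) (sbbp_step (lam k) (state k \<omega>) S)))"
  proof (rule expectation_indep_average[OF simple_function_state J_measurable finite_batches support,
        where g="\<lambda>st S. g st (sbbp_step (lam k) st S)"])
    fix y S
    show "prob ((\<lambda>\<omega>. (state k \<omega>, J k \<omega>)) -` {(y, S)} \<inter> space M)
        = prob (state k -` {y} \<inter> space M) * pmf p S"
      using indep_driven_process(2)[where Y=state and \<Phi>="\<lambda>k. sbbp_step (lam k)",
          OF J_indep finite_batches state_0 state_Suc, of k y S]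
      by (simp add: prob_J)
  qed
  finally show ?thesis .
qed

lemma valid_state: "\<omega> \<in> space M \<Longrightarrow> valid_state Lt R (state k \<omega>)"
proof (induction k)
  case 0
  then show ?case using initial(1) by (simp add: state_0 valid_state_def)
next
  case (Suc k)
  then show ?case
    using valid_state_step[OF J_batches[OF Suc.prems]] by (simp add: state_Suc)
qed

lemma mean_dist_nonneg: "0 \<le> mean_dist k"
  unfolding mean_dist_def using state_dist_nonneg[OF valid_state]
  by (intro integral_nonneg_AE AE_I2)

lemma mean_dist_0: "mean_dist 0 = bregman_dist_set_sq \<psi> xs0 x0 X"
proof -
  have "mean_dist 0 = expectation (\<lambda>\<omega>. bregman_dist_set_sq \<psi> xs0 x0 X)"
    unfolding mean_dist_def
    by (rule Bochner_Integration.integral_cong) (simp_all add: state_0 state_dist_def)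
  then show ?thesis by (simp add: prob_space)
qed

lemma mean_dist_Suc:
  assumes y: "y \<in> X"
  shows "mean_dist (Suc k) \<le> (1 - lam k * (1 - lam k / 2) * \<gamma> * Lt) * mean_dist k
    + R * noise_const \<tau> f p l y * lam k"
proof -
  let ?\<rho> = "1 - lam k * (1 - lam k / 2) * \<gamma> * Lt" and ?c = "R * noise_const \<tau> f p l y * lam k"
  have "mean_dist (Suc k) = expectation (\<lambda>\<omega>. measure_pmf.expectation p
      (\<lambda>S. state_dist (sbbp_step (lam k) (state k \<omega>) S)))"
    unfolding mean_dist_def by (rule expectation_state_Suc)
  also have "\<dots> \<le> expectation (\<lambda>\<omega>. ?\<rho> * state_dist (state k \<omega>) + ?c)"
  proof (rule integral_mono)
    fix \<omega> assume "\<omega> \<in> space M"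
    then show "measure_pmf.expectation p (\<lambda>S. state_dist (sbbp_step (lam k) (state k \<omega>) S))
        \<le> ?\<rho> * state_dist (state k \<omega>) + ?c"
      using lam Lt_pos y by (intro expected_dist_step valid_state) auto
  qed (rule integrable_state)+
  also have "\<dots> = ?\<rho> * mean_dist k + ?c"
    unfolding mean_dist_def by (simp add: prob_space)
  finally show ?thesis .
qed

section \<open>Linear rate and convergence of the mean distance\<close>

theorem mean_dist_linear_rate:
  assumes y: "y \<in> X" "noise_const \<tau> f p l y = 0" and const: "\<And>k. lam k = \<eta>"
  shows "mean_dist k \<le> (1 - \<eta> * (1 - \<eta> / 2) * \<gamma> * Lt) ^ k * mean_dist 0"
proof -
  let ?\<rho> = "1 - \<eta> * (1 - \<eta> / 2) * \<gamma> * Lt"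
  have step: "mean_dist (Suc k) \<le> ?\<rho> * mean_dist k" for k
    using mean_dist_Suc[OF y(1), of k] y(2) const by simp
  show ?thesis
  \<comment> \<open>The induction multiplies an inequality by this factor, so its sign
    matters.\<close>
  proof (cases "?\<rho> \<ge> 0")
    case True
    show ?thesis
    proof (induction k)
      case (Suc k)
      have "mean_dist (Suc k) \<le> ?\<rho> * (?\<rho> ^ k * mean_dist 0)"
        using step[of k] mult_left_mono[OF Suc True] by linarith
      then show ?case by (simp add: mult.assoc)
    qed simp
  next
    case False
    \<comment> \<open>A negative factor is compatible with nonnegative distances only if they all vanish.\<close>
    have "mean_dist k = 0" for k
    proof -
      have "0 \<le> ?\<rho> * mean_dist k" using step[of k] mean_dist_nonneg[of "Suc k"] by linarith
      then show ?thesis using False mean_dist_nonneg[of k] by (auto simp: zero_le_mult_iff)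
    qed
    then show ?thesis by simp
  qed
qed


text \<open>The recursion is run on the weighted mean W, which dominates \<open>mean_dist\<close>.
  The mean ratios \<rho> decrease and are nonnegative, hence converge, so their successive
  differences tend to 0 and \<epsilon> does too.\<close>

theorem mean_dist_tendsto_0:
  assumes lam_0: "lam \<longlonglongrightarrow> 0" and lam_sum: "filterlim (\<lambda>n. \<Sum>k<n. lam k) at_top sequentially"
  shows "mean_dist \<longlonglongrightarrow> 0"
proof -
  obtain A where A: "A \<ge> 0" "\<And>S z. S \<in> set_pmf p \<Longrightarrow> z \<in> X \<Longrightarrow> batch_fun \<tau> f S z - l S \<le> A"
    using batch_gap_minimizers_bounded by blast
  define B where "B = 2 * Lmax / \<mu>"
  define C where "C = (1 + R) * R / 2"
  \<comment> \<open>Half of the contraction rate; the other half is kept to absorb a term in (lam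
    k)^2 * W k.\<close>
  define \<beta> where "\<beta> = \<gamma> * Lt / 2"
  define W where "W k = expectation (\<lambda>\<omega>. (1 + state_ratio (state k \<omega>)) * state_dist (state k \<omega>))" for k
  define \<rho> where "\<rho> k = expectation (\<lambda>\<omega>. state_ratio (state k \<omega>))" for k
  \<comment> \<open>The remaining perturbation over \<beta>, in the shape \<alpha> k * \<epsilon> k
    that the contraction lemma expects.\<close>
  define \<epsilon> where "\<epsilon> k = ((1 + 2 * R) * (2 * A) * (\<rho> k - \<rho> (Suc k)) + lam k * (C * (2 * A))) / \<beta>" for k
  have B: "B > 0" using mu Lmax_pos by (simp add: B_def)
  have C: "C > 0" unfolding C_def by (intro half_gt_zero mult_pos_pos add_pos_pos zero_less_one R_pos)
  have \<beta>: "\<beta> > 0" using gamma Lt_pos by (simp add: \<beta>_def)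
  have ratio: "0 \<le> state_ratio (state k \<omega>)" if "\<omega> \<in> space M" for k \<omega>
    using valid_state[OF that, of k] Lt_pos by (auto simp: valid_state_def state_ratio_def split: prod.splits)
  have dist: "0 \<le> state_dist (state k \<omega>)" if "\<omega> \<in> space M" for k \<omega>
    using state_dist_nonneg[OF valid_state[OF that]] .
  have d_W: "mean_dist k \<le> W k" for k
    unfolding mean_dist_def W_def
  proof (rule integral_mono)
    fix \<omega> assume "\<omega> \<in> space M"
    then show "state_dist (state k \<omega>) \<le> (1 + state_ratio (state k \<omega>)) * state_dist (state k \<omega>)"
      using ratio[of \<omega> k] dist[of \<omega> k] by (simp add: distrib_right)
  qed (rule integrable_state)+
  have "decseq \<rho>"
  proof (rule decseq_SucI)
    fix k
    show "\<rho> (Suc k) \<le> \<rho> k"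
      unfolding \<rho>_def
    proof (rule integral_mono)
      fix \<omega> assume "\<omega> \<in> space M"
      then show "state_ratio (state (Suc k) \<omega>) \<le> state_ratio (state k \<omega>)"
        using state_Suc[of \<omega> k] polyak_ratio_le
        by (cases "state k \<omega>") (simp add: state_ratio_step, simp add: state_ratio_def)
    qed (rule integrable_state)+
  qed
  moreover have "0 \<le> \<rho> k" for k
    unfolding \<rho>_def using ratio by (intro integral_nonneg_AE AE_I2)
  ultimately obtain r where r: "\<rho> \<longlonglongrightarrow> r"
    using decseq_convergent by blast
  have "(\<lambda>k. ((1 + 2 * R) * (2 * A) * (\<rho> k - \<rho> (Suc k)) + lam k * (C * (2 * A))) / \<beta>)
      \<longlonglongrightarrow> ((1 + 2 * R) * (2 * A) * (r - r) + 0 * (C * (2 * A))) / \<beta>"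
    using \<beta> by (intro tendsto_intros r LIMSEQ_Suc[OF r] lam_0) auto
  then have \<epsilon>: "\<epsilon> \<longlonglongrightarrow> 0" unfolding \<epsilon>_def[abs_def] by simp
  have small: "\<forall>\<^sub>F k in sequentially. lam k * c \<le> b" if "c > 0" "b > 0" for b c :: real
  proof -
    have "\<forall>\<^sub>F k in sequentially. lam k < b / c"
      using lam_0 that by (intro order_tendstoD) auto
    then show ?thesis
      by eventually_elim (use that in \<open>simp add: pos_less_divide_eq less_imp_le\<close>)
  qed
  have "W \<longlonglongrightarrow> 0"
  proof (rule contraction_vanishing_noise_tendsto_0[where \<alpha>="\<lambda>k. lam k * \<beta>" and \<epsilon>=\<epsilon>])
    \<comment> \<open>The first smallness condition is the one in
      \<open>expected_weighted_dist_step\<close>; the second lets half of the contraction pay for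
      the quadratic term. Both hold eventually since lam tends to 0.\<close>
    have "\<forall>\<^sub>F k in sequentially. lam k * ((1 + 2 * R) * B) \<le> 1"
      using R_pos B by (intro small) (auto intro!: mult_pos_pos add_pos_pos)
    moreover have "\<forall>\<^sub>F k in sequentially. lam k * (C * B) \<le> \<beta>"
      using C B \<beta> by (intro small) auto
    ultimately show "\<forall>\<^sub>F k in sequentially. W (Suc k) \<le> (1 - lam k * \<beta>) * W k + lam k * \<beta> * \<epsilon> k"
    proof eventually_elim
      case (elim k)
      let ?u = "\<lambda>st. measure_pmf.expectation p (\<lambda>S. state_ratio st - state_ratio (sbbp_step (lam k) st S))"
      have u: "expectation (\<lambda>\<omega>. ?u (state k \<omega>)) = \<rho> k - \<rho> (Suc k)"
        using expectation_state_Suc[of "\<lambda>st st'. state_ratio st - state_ratio st'" k]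
        unfolding \<rho>_def by simp
      have "W (Suc k) = expectation (\<lambda>\<omega>. measure_pmf.expectation p
          (\<lambda>S. (1 + state_ratio (sbbp_step (lam k) (state k \<omega>) S)) * state_dist (sbbp_step (lam k) (state k \<omega>) S)))"
        unfolding W_def by (rule expectation_state_Suc)
      also have "\<dots> \<le> expectation (\<lambda>\<omega>.
          (1 - lam k * Lt * \<gamma>) * ((1 + state_ratio (state k \<omega>)) * state_dist (state k \<omega>))
          + lam k * (1 + 2 * R) * (2 * A) * ?u (state k \<omega>)
          + (lam k)\<^sup>2 * C * (2 * A + B * state_dist (state k \<omega>)))"
      proof (rule integral_mono)
        fix \<omega> assume \<omega>: "\<omega> \<in> space M"
        show "measure_pmf.expectation p (\<lambda>S. (1 + state_ratio (sbbp_step (lam k) (state k \<omega>) S))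
              * state_dist (sbbp_step (lam k) (state k \<omega>) S))
          \<le> (1 - lam k * Lt * \<gamma>) * ((1 + state_ratio (state k \<omega>)) * state_dist (state k \<omega>))
          + lam k * (1 + 2 * R) * (2 * A) * ?u (state k \<omega>)
          + (lam k)\<^sup>2 * C * (2 * A + B * state_dist (state k \<omega>))"
          unfolding B_def C_def
        proof (rule expected_weighted_dist_step[OF lam(1) _ _ _ valid_state[OF \<omega>] A])
          show "lam k * (1 + 2 * R) * (2 * Lmax / \<mu>) \<le> 1"
            using elim(1) by (simp only: B_def mult.assoc)
        qed (use Lt_pos in auto)
      qed (rule integrable_state)+
      also have "\<dots> = (1 - lam k * Lt * \<gamma>) * W k
          + lam k * (1 + 2 * R) * (2 * A) * (\<rho> k - \<rho> (Suc k))
          + (lam k)\<^sup>2 * C * (2 * A + B * mean_dist k)"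
        unfolding W_def mean_dist_def u[symmetric]
        by (subst Bochner_Integration.integral_add integral_mult_right_zero; (rule integrable_state)?)+
           (simp add: prob_space)
      also have "\<dots> \<le> (1 - lam k * Lt * \<gamma>) * W k
          + lam k * (1 + 2 * R) * (2 * A) * (\<rho> k - \<rho> (Suc k))
          + (lam k)\<^sup>2 * C * (2 * A + B * W k)"
        using d_W[of k] B C by (intro add_left_mono mult_left_mono) auto
      also have "\<dots> = (1 - 2 * (lam k * \<beta>)) * W k + lam k * (\<beta> * \<epsilon> k) + lam k * ((lam k * (C * B)) * W k)"
      proof -
        have "\<beta> * \<epsilon> k = (1 + 2 * R) * (2 * A) * (\<rho> k - \<rho> (Suc k)) + lam k * (C * (2 * A))"
          using \<beta> by (simp add: \<epsilon>_def)
        then show ?thesis by (simp only:) (simp add: \<beta>_def algebra_simps power2_eq_square)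
      qed
      also have "\<dots> \<le> (1 - 2 * (lam k * \<beta>)) * W k + lam k * (\<beta> * \<epsilon> k) + lam k * (\<beta> * W k)"
        using elim(2) lam(1)[of k] order_trans[OF mean_dist_nonneg d_W]
        by (intro add_left_mono mult_left_mono mult_right_mono) auto
      also have "\<dots> = (1 - lam k * \<beta>) * W k + lam k * \<beta> * \<epsilon> k"
        by (simp add: algebra_simps)
      finally show ?case .
    qed
    show "\<forall>\<^sub>F k in sequentially. 0 \<le> lam k * \<beta> \<and> lam k * \<beta> \<le> 1"
      using small[OF \<beta> zero_less_one] by eventually_elim (use lam(1) \<beta> in \<open>auto simp: less_imp_le\<close>)
    show "filterlim (\<lambda>n. \<Sum>k<n. lam k * \<beta>) at_top sequentially"
      unfolding sum_distrib_right[symmetric]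
      by (rule filterlim_at_top_mult_tendsto_pos[OF tendsto_const \<beta> lam_sum])
    show "0 \<le> W k" for k using order_trans[OF mean_dist_nonneg d_W] .
  qed (rule \<epsilon>)
  then show ?thesis
    by (rule tendsto_sandwich[rotated -1, OF _ _ _ tendsto_const]) (use mean_dist_nonneg d_W in auto)
qed

end

section \<open>The two stepsize schedules\<close>

theorem corollary2:
  fixes \<psi> :: "real ^ 'n \<Rightarrow> real"
    and f :: "nat \<Rightarrow> real ^ 'n \<Rightarrow> real"
    and L :: "nat \<Rightarrow> real"
    and m \<tau> :: nat
    and \<mu> \<gamma> \<gamma>\<^sub>b Lt \<sigma>2 :: real
    and F :: "real ^ 'n \<Rightarrow> real"
    and X :: "(real ^ 'n) set"
    and M :: "'w measure"
    and p :: "nat set pmf"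
    and J :: "nat \<Rightarrow> 'w \<Rightarrow> nat set"
    and l :: "nat set \<Rightarrow> real"
    and lam :: "nat \<Rightarrow> real"
    and t :: "nat \<Rightarrow> 'w \<Rightarrow> real"
    and x xs :: "nat \<Rightarrow> 'w \<Rightarrow> real ^ 'n"
    and x0 xs0 xhat :: "real ^ 'n"
  assumes psi: "\<mu> > 0" "strongly_convex \<mu> \<psi>"
    and f_conv: "\<And>i. i \<in> {1..m} \<Longrightarrow> convex_on UNIV (f i)"
    and f_diff: "\<And>i y. i \<in> {1..m} \<Longrightarrow> f i differentiable (at y)"
    and f_lip: "\<And>i. i \<in> {1..m} \<Longrightarrow> L i > 0 \<and> (L i)-lipschitz_on UNIV (grad (f i))"
    and F: "F = mean_fun m f"
    and X: "X = minimizers F" "X \<noteq> {}"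
    and growth: "\<gamma> > 0" "bregman_growth \<psi> F \<gamma>"
    and tau: "\<tau> \<in> {1..m}"
    and sampling_distribution: "set_pmf p \<subseteq> batches m \<tau>"
      "\<And>i. i \<in> {1..m} \<Longrightarrow> measure_pmf.prob p {S. i \<in> S} = real \<tau> / real m"
    and M: "prob_space M"
    and J_indep: "prob_space.indep_vars M (\<lambda>_. count_space (batches m \<tau>)) J UNIV"
    and J_distr: "\<And>k. distr M (count_space UNIV) (J k) = measure_pmf p"
    and lower_bound: "\<And>S. S \<in> batches m \<tau> \<Longrightarrow> ereal (l S) \<le> (INF y. ereal (batch_fun \<tau> f S y))"
    and lam: "decseq lam" "\<And>k. 0 < lam k" "\<And>k. lam k < 2"
    and gamma_b: "\<gamma>\<^sub>b > 0"
    and initial: "xs0 \<in> subdifferential \<psi> x0"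
      "\<And>\<omega>. \<omega> \<in> space M \<Longrightarrow> x 0 \<omega> = x0 \<and> xs 0 \<omega> = xs0"
    and iterates: "\<And>\<omega>. \<omega> \<in> space M \<Longrightarrow>
      sbbp \<psi> \<tau> f (\<lambda>k. J k \<omega>) (\<lambda>k. t k \<omega>) (\<lambda>k. x k \<omega>) (\<lambda>k. xs k \<omega>)"
    and stepsizes: "\<And>\<omega>. \<omega> \<in> space M \<Longrightarrow>
      decmsps \<mu> \<tau> f l lam \<gamma>\<^sub>b (\<lambda>k. J k \<omega>) (\<lambda>k. x k \<omega>) (\<lambda>k. t k \<omega>)"
    and noise: "xhat \<in> X" "\<sigma>2 = noise_const \<tau> f p l xhat"
    and Lt: "Lt = min (\<mu> / (2 * Max (L ` {1..m}))) (\<gamma>\<^sub>b / lam 0)"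
  shows
    "(\<sigma>2 = 0 \<longrightarrow> (\<forall>c > 1 / 2. (\<forall>k. lam k = 1 / c) \<longrightarrow>
        (\<forall>k. prob_space.expectation M (\<lambda>\<omega>. bregman_dist_set_sq \<psi> (xs k \<omega>) (x k \<omega>) X)
           \<le> (1 - 1 / c * (1 - 1 / (2 * c)) * \<gamma> * Lt) ^ k * bregman_dist_set_sq \<psi> xs0 x0 X)))
     \<and> (\<sigma>2 > 0 \<longrightarrow> (\<forall>c > 0. (\<forall>k. lam k = 1 / (c * sqrt (real k + 1))) \<longrightarrow>
        (\<lambda>k. prob_space.expectation M (\<lambda>\<omega>. bregman_dist_set_sq \<psi> (xs k \<omega>) (x k \<omega>) X)) \<longlonglongrightarrow> 0 \<and>
        (\<forall>k. prob_space.expectation M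
               (\<lambda>\<omega>. bregman_dist_set_sq \<psi> (xs (Suc k) \<omega>) (x (Suc k) \<omega>) X)
           \<le> (1 - 1 / (c * sqrt (real k + 1)) * (1 - 1 / (2 * c * sqrt (real k + 1))) * \<gamma> * Lt)
               * prob_space.expectation M (\<lambda>\<omega>. bregman_dist_set_sq \<psi> (xs k \<omega>) (x k \<omega>) X)
             + \<gamma>\<^sub>b / lam 0 * (\<sigma>2 / (c * sqrt (real k + 1))))))"
proof -
  \<comment> \<open>The infimum is taken in the extended reals; here its bound becomes a real bound
    at each point.\<close>
  have lower: "l S \<le> batch_fun \<tau> f S y" if "S \<in> batches m \<tau>" for S y
  proof -
    have "ereal (l S) \<le> ereal (batch_fun \<tau> f S y)"
      using lower_bound[OF that] by (rule order_trans) (rule INF_lower, simp)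
    then show ?thesis by simp
  qed
  interpret prob_space M by (rule M)
  interpret sbbp_process \<psi> f L m \<tau> \<mu> \<gamma> F X p l M J lam \<gamma>\<^sub>b t x xs x0 xs0
    by unfold_locales (fact psi f_conv f_diff f_lip F X growth tau sampling_distribution lower
      J_indep J_distr lam gamma_b initial iterates stepsizes)+
  note Lt = Lt[symmetric]
  have linear: "mean_dist k \<le> (1 - 1 / c * (1 - 1 / (2 * c)) * \<gamma> * Lt) ^ k * mean_dist 0"
    if "\<sigma>2 = 0" "\<forall>k. lam k = 1 / c" for c k
  proof -
    have "mean_dist k \<le> (1 - 1 / c * (1 - 1 / c / 2) * \<gamma> * Lt) ^ k * mean_dist 0"
      using mean_dist_linear_rate[OF noise(1), of "1 / c" k, unfolded Lt] that noise(2) by simp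
    then show ?thesis by (simp add: mult.commute)
  qed
  have recursion: "mean_dist (Suc k)
      \<le> (1 - 1 / (c * sqrt (real k + 1)) * (1 - 1 / (2 * c * sqrt (real k + 1))) * \<gamma> * Lt) * mean_dist k
        + \<gamma>\<^sub>b / lam 0 * (\<sigma>2 / (c * sqrt (real k + 1)))"
    if "lam k = 1 / (c * sqrt (real k + 1))" for c k
    using mean_dist_Suc[OF noise(1), of k]
    unfolding Lt noise(2)[symmetric] that by (simp add: mult_ac)
  \<comment> \<open>This schedule meets both requirements: it tends to 0, while its partial sums
    grow at least like sqrt n / c.\<close>
  have limit: "mean_dist \<longlonglongrightarrow> 0" if c: "c > 0" and lam_eq: "\<forall>k. lam k = 1 / (c * sqrt (real k + 1))" for c
  proof (rule mean_dist_tendsto_0)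
    have lam_fun: "lam = (\<lambda>k. 1 / c * (1 / sqrt (real k + 1)))" using lam_eq by (simp add: fun_eq_iff)
    have "filterlim (\<lambda>k. real k + 1) at_top sequentially"
      using filterlim_tendsto_add_at_top[OF tendsto_const filterlim_real_sequentially, of 1]
      by (simp add: add.commute)
    then have "(\<lambda>k. inverse (sqrt (real k + 1))) \<longlonglongrightarrow> 0"
      by (intro tendsto_inverse_0_at_top filterlim_compose[OF sqrt_at_top])
    from tendsto_mult_right_zero[OF this, of "1 / c"] show "lam \<longlonglongrightarrow> 0"
      unfolding lam_fun by (simp add: inverse_eq_divide)
    show "filterlim (\<lambda>n. \<Sum>k<n. lam k) at_top sequentially"
      unfolding lam_fun sum_distrib_left[symmetric] using c
      by (intro filterlim_tendsto_pos_mult_at_top[OF tendsto_const _ sum_inverse_sqrt_at_top]) simp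
  qed
  show ?thesis
    unfolding mean_dist_eq[symmetric] mean_dist_0[symmetric]
    using linear recursion limit by blast
qed

end
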